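(* Let $G_o$ be a non-compact unimodular lcsc group acting jointly continuously on Polish spaces $X_1,\dots,X_r$ with separated cross sections $Z_1,\dots,Z_r$ respectively, and for each $k$ let $\mu_k$ be a $G_o$-invariant Borel probability measure on $X_k$ with transverse measure $\nu_k$ on $Z_k$. If $Z_1,\dots,Z_r$ are commensurable, then for $\nu_1\otimes\dots\otimes\nu_r$-almost all $(z_1,\dots,z_r)\in Z_1\times\dots\times Z_r$ there exists a sequence $(g_n)$ in $(Z_1)_{z_1}\cap\dots\cap(Z_r)_{z_r}$ such that $$g_n.z_1\to z_1,\quad\dots,\quad g_n.z_r\to z_r\quad\text{and}\quad g_n\to\infty.$$
   Context: lcsc = locally compact second countable; $m_{G_o}$ is a fixed Haar measure on $G_o$; $g_n\to\infty$ means that $(g_n)$ eventually leaves every compact set. For a Borel action of an lcsc group $H$ on a standard Borel space $S$, a Borel set $T\subset S$ is a cross section if $H.T=S$; it is separated if $\{h\in H: h.T\cap T\ne\emptyset\}\cap U=\{e\}$ for some identity neighbourhood $U$ in $H$. For $s\in S$, $T_s:=\{h\in H:h.s\in T\}$; in particular $(Z_k)_{z}=\{g\in G_o:g.z\in Z_k\}$. If $T$ is a separated cross section and $\mu$ is a finite $H$-invariant Borel measure on $S$, the transverse measure of $\mu$ on $T$ is the unique Borel measure $\nu$ on $T$ such that for all bounded non-negative Borel $f$ on $H\times T$: $\int_S\sum_{h\in T_s}f(h^{-1},h.s)\,d\mu(s)=\int_H\int_T f(h,t)\,d\nu(t)\,dm_H(h)$. Put $X:=X_1\times\dots\times X_r$,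 with the product action of $G_o^r$, and $X^{[r]}:=\{(x_1,\dots,x_r)\in X:\exists g\in G_o:\ g.x_1\in Z_1,\dots,g.x_r\in Z_r\}$, a Borel subset of $X$. For $k\in\{1,\dots,r\}$ let $N_k<G_o^r$ be the kernel of the $k$-th coordinate projection. $Z_1,\dots,Z_r$ are called commensurable if $X^{[r]}$ is a separated cross section for the $N_k$-action on $X$ for every $k\in\{1,\dots,r\}$. *)

theory Defs
  imports "HOL-Probability.Probability" "HOL-Library.Function_Algebras"
begin

text \<open>
  Groups are written additively, because the library's classes for topological groups are additive;
  \<open>group_add\<close> and \<open>topological_group_add\<close> do not assume commutativity.
  An lcsc group is a type of sort
  \<open>{topological_group_add, second_countable_topology, t2_space}\<close>
  which satisfies \<open>locally_compact_space euclidean\<close>. Its power over a finite index type \<open>'i\<close> is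
  \<open>'i \<Rightarrow> 'g\<close>, with pointwise operations and the product topology.
  The Polish spaces carry abstract topologies, so that a family of pairwise different spaces can be
  indexed by \<open>'i\<close>.
\<close>

definition polish_topology :: "'x topology \<Rightarrow> bool" where
  "polish_topology X \<longleftrightarrow> completely_metrizable_space X \<and> second_countable X"

definition borel_of :: "'x topology \<Rightarrow> 'x measure" where
  "borel_of X = sigma (topspace X) {U. openin X U}"

definition continuous_action ::
    "('g::{topological_space, group_add} \<Rightarrow> 'x \<Rightarrow> 'x) \<Rightarrow> 'x topology \<Rightarrow> bool" where
  "continuous_action act X \<longleftrightarrow>
     (\<forall>x\<in>topspace X. act 0 x = x) \<and>
     (\<forall>g h. \<forall>x\<in>topspace X. act (g + h) x = act g (act h x)) \<and>
     continuous_map (prod_topology euclidean X) X (\<lambda>(g, x). act g x)"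

text \<open>
  On an lcsc space a Borel measure which is finite on compact sets is automatically regular,
  so regularity is not part of the definition.
\<close>

definition left_haar_measure :: "'g::{topological_space, group_add} measure \<Rightarrow> bool" where
  "left_haar_measure m \<longleftrightarrow>
     sets m = sets borel \<and> emeasure m UNIV \<noteq> 0 \<and>
     (\<forall>K. compact K \<longrightarrow> emeasure m K < \<infinity>) \<and>
     (\<forall>g. distr m borel (\<lambda>h. g + h) = m)"

definition unimodular :: "'g::{topological_space, group_add} itself \<Rightarrow> bool" where
  "unimodular _ \<longleftrightarrow>
     (\<forall>m :: 'g measure. left_haar_measure m \<longrightarrow> (\<forall>g. distr m borel (\<lambda>h. h + g) = m))"

definition invariant_measure :: "('g \<Rightarrow> 'x \<Rightarrow> 'x) \<Rightarrow> 'x measure \<Rightarrow> bool" where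
  "invariant_measure act \<mu> \<longleftrightarrow> (\<forall>g. act g \<in> \<mu> \<rightarrow>\<^sub>M \<mu> \<and> distr \<mu> \<mu> (act g) = \<mu>)"

text \<open>
  The acting group is a subgroup \<open>H\<close> of the ambient topological group, with the subspace topology;
  \<open>S\<close> carries the Borel structure of the space acted upon.
\<close>

definition cross_section :: "'h set \<Rightarrow> ('h \<Rightarrow> 's \<Rightarrow> 's) \<Rightarrow> 's measure \<Rightarrow> 's set \<Rightarrow> bool" where
  "cross_section H act S T \<longleftrightarrow> T \<in> sets S \<and> (\<Union>h\<in>H. act h ` T) = space S"

definition separated_cross_section ::
    "'h::{topological_space, zero} set \<Rightarrow> ('h \<Rightarrow> 's \<Rightarrow> 's) \<Rightarrow> 's measure \<Rightarrow> 's set \<Rightarrow> bool" where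
  "separated_cross_section H act S T \<longleftrightarrow>
     cross_section H act S T \<and>
     (\<exists>U. openin (top_of_set H) U \<and> 0 \<in> U \<and> {h\<in>H. act h ` T \<inter> T \<noteq> {}} \<inter> U = {0})"

definition return_set :: "('g \<Rightarrow> 's \<Rightarrow> 's) \<Rightarrow> 's set \<Rightarrow> 's \<Rightarrow> 'g set" where
  "return_set act T s = {g. act g s \<in> T}"

text \<open>
  For a separated cross section \<open>T\<close> and a finite invariant \<open>\<mu>\<close> there is exactly one such \<open>\<nu>\<close>.
  The integrals and sums are taken in the extended nonnegative reals, since they need not be finite
  for a bounded \<open>f\<close>.
\<close>

definition transverse_measure ::
    "'g::{topological_space, group_add} measure \<Rightarrow> ('g \<Rightarrow> 's \<Rightarrow> 's) \<Rightarrow> 's measure \<Rightarrow> 's set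
      \<Rightarrow> 's measure \<Rightarrow> bool" where
  "transverse_measure m act \<mu> T \<nu> \<longleftrightarrow>
     sets \<nu> = sets (restrict_space \<mu> T) \<and>
     (\<forall>f :: 'g \<times> 's \<Rightarrow> real.
        f \<in> borel_measurable (m \<Otimes>\<^sub>M \<nu>) \<and> (\<exists>C. \<forall>h. \<forall>t\<in>T. 0 \<le> f (h, t) \<and> f (h, t) \<le> C) \<longrightarrow>
        (\<integral>\<^sup>+ s. (\<Sum>\<^sub>\<infinity>h\<in>return_set act T s. ennreal (f (- h, act h s))) \<partial>\<mu>) =
        (\<integral>\<^sup>+ h. (\<integral>\<^sup>+ t. ennreal (f (h, t)) \<partial>\<nu>) \<partial>m))"

definition product_action :: "('i \<Rightarrow> 'g \<Rightarrow> 'x \<Rightarrow> 'x) \<Rightarrow> ('i \<Rightarrow> 'g) \<Rightarrow> ('i \<Rightarrow> 'x) \<Rightarrow> ('i \<Rightarrow> 'x)" where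
  "product_action act g x = (\<lambda>k. act k (g k) (x k))"

definition intersection_space ::
    "('i \<Rightarrow> 'x topology) \<Rightarrow> ('i \<Rightarrow> 'g \<Rightarrow> 'x \<Rightarrow> 'x) \<Rightarrow> ('i \<Rightarrow> 'x set) \<Rightarrow> ('i \<Rightarrow> 'x) set" where
  "intersection_space X act Z =
     {x \<in> topspace (product_topology X UNIV). \<exists>g. \<forall>k. act k g (x k) \<in> Z k}"

definition coordinate_kernel :: "'i \<Rightarrow> ('i \<Rightarrow> 'g::zero) set" where
  "coordinate_kernel k = {g. g k = 0}"

definition commensurable ::
    "('i::finite \<Rightarrow> 'x topology) \<Rightarrow> ('i \<Rightarrow> 'g::{topological_space, zero} \<Rightarrow> 'x \<Rightarrow> 'x)
      \<Rightarrow> ('i \<Rightarrow> 'x set) \<Rightarrow> bool" where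
  "commensurable X act Z \<longleftrightarrow>
     (\<forall>k. separated_cross_section (coordinate_kernel k) (product_action act)
            (borel_of (product_topology X UNIV)) (intersection_space X act Z))"

definition tends_to_infinity :: "(nat \<Rightarrow> 'g::topological_space) \<Rightarrow> bool" where
  "tends_to_infinity g \<longleftrightarrow> (\<forall>K. compact K \<longrightarrow> (\<forall>\<^sub>F n in sequentially. g n \<notin> K))"

end

theory Submission
  imports Defs
begin

text \<open>
  For small \<open>Q\<close> in \<open>G\<close> the transverse formula says that the map \<open>(h, t) \<mapsto> h.t\<close> pushes
  \<open>m|Q \<otimes> \<nu>\<^sub>k\<close> to a measure below \<open>\<mu>\<^sub>k\<close>. Let \<open>B\<close> be a compact set of points of
  \<open>Z\<^sub>1 \<times> \<dots> \<times> Z\<^sub>r\<close> whose diagonal return times to \<open>B\<close> all lie in a compact set \<open>K\<close>. Choose a compact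
  identity neighbourhood \<open>V\<close> and \<open>N\<close> elements \<open>g\<close> with disjoint translates \<open>V g\<close>, and cut the boxes
  \<open>V g \<times> \<dots> \<times> V g\<close> into products of small pieces. By commensurability the images of
  \<open>(V g \<times> \<dots> \<times> V g) \<times> B\<close> under the action cover each point of \<open>X\<close> at most as often as an orbit
  returns during \<open>K\<close>, which is bounded by some \<open>M\<close>. By unimodularity all boxes have the same mass, so
  \<open>N m(V)\<^sup>r \<nu>(B) \<le> M\<close> for all \<open>N\<close>, and \<open>\<nu>(B) = 0\<close>.
  Applied to the points of a basic open set that do not return to it outside \<open>K\<close>, this gives the
  recurrence. Inner regularity of finite Borel measures on Polish
  spaces reduces everything to \<open>\<sigma>\<close>-compact sets, whose images under the action are again Borel.
\<close>

subsection \<open>Countable unions of compact sets\<close>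

text \<open>Two kinds of smallness compete, because the group need not be commutative. The map
  \<open>(h, t) \<mapsto> h.t\<close> is injective on pieces with small left differences
  \<open>- a + b\<close>, whereas the kernel part \<open>h j - h k0\<close> of an element of a box
  is a right difference. Right differences of \<open>V + g\<close> do not depend on
  \<open>g\<close>, so separation along a kernel can be exploited with one fixed \<open>V\<close>
  and arbitrarily many translates. This dictates right translates, and with them unimodularity,
  since Haar measure is only left invariant. Left differences of \<open>V + g\<close> are conjugated
  by \<open>g\<close> and may become large. Hence the boxes are cut into pieces only after the
  translates have been chosen. The number of pieces is harmless: multiplicity is counted over all of
  them at once, and their masses add up to those of the boxes. Non-compactness supplies as many
  disjoint translates as desired, while the product of the \<open>\<mu> k\<close> has total mass
  1.\<close>

definition sigma_compactin :: "'a topology \<Rightarrow> 'a set \<Rightarrow> bool" where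
  "sigma_compactin X S \<longleftrightarrow> (\<exists>\<C>. countable \<C> \<and> (\<forall>C\<in>\<C>. compactin X C) \<and> \<Union>\<C> = S)"

lemma compactin_imp_sigma_compactin: "compactin X C \<Longrightarrow> sigma_compactin X C"
  unfolding sigma_compactin_def by (rule exI[of _ "{C}"]) auto

lemma sigma_compactin_subset_topspace: "sigma_compactin X S \<Longrightarrow> S \<subseteq> topspace X"
  unfolding sigma_compactin_def using compactin_subset_topspace by blast

lemma sigma_compactin_Union:
  assumes "countable \<S>" and "\<And>S. S \<in> \<S> \<Longrightarrow> sigma_compactin X S"
  shows "sigma_compactin X (\<Union>\<S>)"
proof -
  obtain \<C> where \<C>: "\<And>S. S \<in> \<S> \<Longrightarrow>
      countable (\<C> S) \<and> (\<forall>C\<in>\<C> S. compactin X C) \<and> \<Union>(\<C> S) = S"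
    using assms(2) unfolding sigma_compactin_def by metis
  then show ?thesis
    unfolding sigma_compactin_def using assms(1)
    by (intro exI[of _ "\<Union>S\<in>\<S>. \<C> S"]) (fastforce intro!: countable_UN)
qed

lemma sigma_compactin_UN:
  assumes "countable I" and "\<And>i. i \<in> I \<Longrightarrow> sigma_compactin X (S i)"
  shows "sigma_compactin X (\<Union>i\<in>I. S i)"
  using assms by (intro sigma_compactin_Union) auto

lemma sigma_compactin_Int_closedin:
  assumes "sigma_compactin X S" and "closedin X D"
  shows "sigma_compactin X (S \<inter> D)"
proof -
  obtain \<C> where \<C>: "countable \<C>" "\<And>C. C \<in> \<C> \<Longrightarrow> compactin X C" "\<Union>\<C> = S"
    using assms(1) unfolding sigma_compactin_def by metis
  have "S \<inter> D = (\<Union>C\<in>\<C>. D \<inter> C)" using \<C>(3) by auto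
  then show ?thesis
    using sigma_compactin_UN[of \<C> X "\<lambda>C. D \<inter> C"] \<C> assms(2)
    by (simp add: closed_Int_compactin compactin_imp_sigma_compactin)
qed

lemma sigma_compactin_Int_fsigma_in:
  assumes "sigma_compactin X S" and "fsigma_in X D"
  shows "sigma_compactin X (S \<inter> D)"
proof -
  obtain C where C: "\<And>n::nat. closedin X (C n)" "\<Union>(range C) = D"
    using assms(2) unfolding fsigma_in_ascending by metis
  have "S \<inter> D = (\<Union>n. S \<inter> C n)" using C(2) by auto
  then show ?thesis
    using sigma_compactin_UN[of UNIV X "\<lambda>n. S \<inter> C n"] C(1) assms(1)
    by (simp add: sigma_compactin_Int_closedin)
qed

lemma sigma_compactin_imp_fsigma_in:
  assumes "Hausdorff_space X" and "sigma_compactin X S"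
  shows "fsigma_in X S"
  using assms unfolding sigma_compactin_def fsigma_in_def union_of_def
  by (metis compactin_imp_closedin mem_Collect_eq subsetI)

lemma sigma_compactin_Int:
  assumes "Hausdorff_space X" and "sigma_compactin X S" and "sigma_compactin X T"
  shows "sigma_compactin X (S \<inter> T)"
  using assms sigma_compactin_Int_fsigma_in sigma_compactin_imp_fsigma_in by blast

text \<open>Borel sets lack this closure property: a continuous image of a Borel set is in general
  only analytic. Action images and projections are therefore formed inside this smaller
  class.\<close>

lemma sigma_compactin_image:
  assumes "sigma_compactin X S" and "continuous_map X Y f"
  shows "sigma_compactin Y (f ` S)"
proof -
  obtain \<C> where \<C>: "countable \<C>" "\<And>C. C \<in> \<C> \<Longrightarrow> compactin X C" "\<Union>\<C> = S"
    using assms(1) unfolding sigma_compactin_def by metis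
  have "f ` S = (\<Union>C\<in>\<C>. f ` C)" using \<C>(3) by auto
  moreover have "sigma_compactin Y (\<Union>C\<in>\<C>. f ` C)"
    using \<C> assms(2)
    by (intro sigma_compactin_UN compactin_imp_sigma_compactin) (auto intro: image_compactin)
  ultimately show ?thesis by simp
qed

lemma sigma_compactin_Times:
  assumes "sigma_compactin X S" and "sigma_compactin Y T"
  shows "sigma_compactin (prod_topology X Y) (S \<times> T)"
proof -
  obtain \<C> where \<C>: "countable \<C>" "\<And>C. C \<in> \<C> \<Longrightarrow> compactin X C" "\<Union>\<C> = S"
    using assms(1) unfolding sigma_compactin_def by metis
  obtain \<D> where \<D>: "countable \<D>" "\<And>C. C \<in> \<D> \<Longrightarrow> compactin Y C" "\<Union>\<D> = T"
    using assms(2) unfolding sigma_compactin_def by metis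
  have "S \<times> T = (\<Union>p\<in>\<C> \<times> \<D>. fst p \<times> snd p)" using \<C>(3) \<D>(3) by auto
  moreover have "sigma_compactin (prod_topology X Y) (\<Union>p\<in>\<C> \<times> \<D>. fst p \<times> snd p)"
    using \<C> \<D>
    by (intro sigma_compactin_UN) (auto intro!: compactin_imp_sigma_compactin simp: compactin_Times)
  ultimately show ?thesis by simp
qed

text \<open>Finiteness of \<open>I\<close> keeps the choices of one compact piece per coordinate
  countable; each product of chosen pieces is compact by Tychonoff.\<close>

lemma sigma_compactin_PiE:
  assumes "finite I" and "\<And>i. i \<in> I \<Longrightarrow> sigma_compactin (X i) (S i)"
  shows "sigma_compactin (product_topology X I) (Pi\<^sub>E I S)"
proof -
  obtain \<C> where \<C>: "\<And>i. i \<in> I \<Longrightarrow> countable (\<C> i)"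
    "\<And>i C. i \<in> I \<Longrightarrow> C \<in> \<C> i \<Longrightarrow> compactin (X i) C" "\<And>i. i \<in> I \<Longrightarrow> \<Union>(\<C> i) = S i"
    using assms(2) unfolding sigma_compactin_def by metis
  have "Pi\<^sub>E I S = (\<Union>c\<in>Pi\<^sub>E I \<C>. Pi\<^sub>E I c)"
  proof (intro equalityI subsetI)
    fix x assume x: "x \<in> Pi\<^sub>E I S"
    then have "\<forall>i\<in>I. \<exists>C\<in>\<C> i. x i \<in> C" by (metis PiE_mem \<C>(3) UnionE)
    then obtain c where c: "\<And>i. i \<in> I \<Longrightarrow> c i \<in> \<C> i \<and> x i \<in> c i" by metis
    then have "restrict c I \<in> Pi\<^sub>E I \<C>" and "x \<in> Pi\<^sub>E I (restrict c I)"
      using x by (simp_all add: PiE_iff restrict_PiE_iff)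
    then show "x \<in> (\<Union>c\<in>Pi\<^sub>E I \<C>. Pi\<^sub>E I c)" by blast
  next
    fix x assume "x \<in> (\<Union>c\<in>Pi\<^sub>E I \<C>. Pi\<^sub>E I c)"
    then obtain c where c: "c \<in> Pi\<^sub>E I \<C>" "x \<in> Pi\<^sub>E I c" by blast
    then have "c i \<subseteq> S i" if "i \<in> I" for i
      using that by (metis PiE_mem \<C>(3) Union_upper)
    then have "Pi\<^sub>E I c \<subseteq> Pi\<^sub>E I S" by (rule PiE_mono)
    then show "x \<in> Pi\<^sub>E I S" using c(2) by blast
  qed
  moreover have "sigma_compactin (product_topology X I) (\<Union>c\<in>Pi\<^sub>E I \<C>. Pi\<^sub>E I c)"
  proof (rule sigma_compactin_UN)
    show "countable (Pi\<^sub>E I \<C>)" using assms(1) \<C>(1) by (rule countable_PiE)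
    fix c assume "c \<in> Pi\<^sub>E I \<C>"
    then have "compactin (X i) (c i)" if "i \<in> I" for i
      using \<C>(2)[OF that] that by (meson PiE_mem)
    then have "compactin (product_topology X I) (Pi\<^sub>E I c)" unfolding compactin_PiE by blast
    then show "sigma_compactin (product_topology X I) (Pi\<^sub>E I c)"
      by (rule compactin_imp_sigma_compactin)
  qed
  ultimately show ?thesis by simp
qed

subsection \<open>Borel sets of abstract topologies\<close>

lemma space_borel_of [simp]: "space (borel_of X) = topspace X"
  unfolding borel_of_def by (auto intro!: space_measure_of openin_subset)

lemma sets_borel_of: "sets (borel_of X) = sigma_sets (topspace X) {U. openin X U}"
  unfolding borel_of_def by (auto intro!: sets_measure_of openin_subset)

lemma openin_sets_borel_of: "openin X U \<Longrightarrow> U \<in> sets (borel_of X)"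
  by (simp add: sets_borel_of sigma_sets.Basic)

lemma closedin_sets_borel_of:
  assumes "closedin X C" shows "C \<in> sets (borel_of X)"
proof -
  have "topspace X - (topspace X - C) \<in> sets (borel_of X)"
    using assms by (metis openin_sets_borel_of openin_topspace openin_diff sets.Diff
        openin_closedin_eq)
  then show ?thesis using closedin_subset[OF assms] by (simp add: double_diff)
qed

lemma sigma_compactin_sets_borel_of:
  assumes "Hausdorff_space X" and "sigma_compactin X S"
  shows "S \<in> sets (borel_of X)"
  using assms unfolding sigma_compactin_def
  by (metis closedin_sets_borel_of compactin_imp_closedin sets.countable_Union subsetI)

lemma measurable_borel_ofI:
  assumes "f \<in> space M \<rightarrow> topspace X"
    and "\<And>U. openin X U \<Longrightarrow> f -` U \<inter> space M \<in> sets M"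
  shows "f \<in> M \<rightarrow>\<^sub>M borel_of X"
  unfolding borel_of_def using assms by (intro measurable_measure_of) (auto dest: openin_subset)

lemma continuous_map_measurable:
  assumes "continuous_map X Y f"
  shows "f \<in> borel_of X \<rightarrow>\<^sub>M borel_of Y"
proof (rule measurable_borel_ofI)
  show "f \<in> space (borel_of X) \<rightarrow> topspace Y"
    using continuous_map_funspace[OF assms] by simp
  fix U assume "openin Y U"
  from openin_continuous_map_preimage[OF assms this]
  have "{x \<in> topspace X. f x \<in> U} \<in> sets (borel_of X)" by (rule openin_sets_borel_of)
  moreover have "f -` U \<inter> space (borel_of X) = {x \<in> topspace X. f x \<in> U}" by auto
  ultimately show "f -` U \<inter> space (borel_of X) \<in> sets (borel_of X)" by simp
qed

lemma sets_borel_of_euclidean [simp]: "sets (borel_of euclidean) = sets borel"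
  by (simp add: sets_borel_of borel_def)

lemma second_countable_euclidean:
  "second_countable (euclidean :: 'a::second_countable_topology topology)"
proof -
  obtain B :: "'a set set" where "countable B" "topological_basis B"
    using ex_countable_basis by blast
  then show ?thesis
    unfolding second_countable_def by (metis open_openin topological_basisE topological_basis_open)
qed

text \<open>The box form is kept in the statement so that the same base gives both second
  countability of the product and membership of its open sets in the product
  \<sigma>-algebra.\<close>

lemma second_countable_PiE_base:
  assumes "finite I" and "\<forall>i\<in>I. second_countable (X i)"
  shows "\<exists>\<B>. countable \<B> \<and>
    (\<forall>V\<in>\<B>. \<exists>U. (\<forall>i\<in>I. openin (X i) (U i)) \<and> V = Pi\<^sub>E I U) \<and>
    (\<forall>U x. openin (product_topology X I) U \<and> x \<in> U \<longrightarrow> (\<exists>V\<in>\<B>. x \<in> V \<and> V \<subseteq> U))"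
proof -
  obtain \<B> where \<B>: "\<And>i. i \<in> I \<Longrightarrow> countable (\<B> i)"
    "\<And>i V. i \<in> I \<Longrightarrow> V \<in> \<B> i \<Longrightarrow> openin (X i) V"
    "\<And>i U x. i \<in> I \<Longrightarrow> openin (X i) U \<Longrightarrow> x \<in> U \<Longrightarrow> \<exists>V\<in>\<B> i. x \<in> V \<and> V \<subseteq> U"
    using assms(2) unfolding second_countable_def by metis
  show ?thesis
  proof (intro exI[of _ "Pi\<^sub>E I ` Pi\<^sub>E I \<B>"] conjI ballI allI impI)
    show "countable (Pi\<^sub>E I ` Pi\<^sub>E I \<B>)"
      using \<B>(1) assms(1) by (intro countable_image countable_PiE)
    show "\<exists>U. (\<forall>i\<in>I. openin (X i) (U i)) \<and> V = Pi\<^sub>E I U" if *: "V \<in> Pi\<^sub>E I ` Pi\<^sub>E I \<B>" for V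
    proof -
      obtain U where "U \<in> Pi\<^sub>E I \<B>" "V = Pi\<^sub>E I U" using * by blast
      then show ?thesis using \<B>(2) by (intro exI[of _ U]) (simp add: PiE_iff)
    qed
    fix U x assume "openin (product_topology X I) U \<and> x \<in> U"
    then obtain W where W: "\<And>i. i \<in> I \<Longrightarrow> openin (X i) (W i)" "x \<in> Pi\<^sub>E I W" "Pi\<^sub>E I W \<subseteq> U"
      unfolding openin_product_topology_alt by metis
    have "\<forall>i\<in>I. \<exists>V\<in>\<B> i. x i \<in> V \<and> V \<subseteq> W i" using W(1,2) \<B>(3) by (meson PiE_mem)
    then obtain V where V: "\<And>i. i \<in> I \<Longrightarrow> V i \<in> \<B> i \<and> x i \<in> V i \<and> V i \<subseteq> W i" by metis
    have "restrict V I \<in> Pi\<^sub>E I \<B>" using V by (simp add: restrict_PiE_iff)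
    then have "Pi\<^sub>E I (restrict V I) \<in> Pi\<^sub>E I ` Pi\<^sub>E I \<B>" by (rule imageI)
    moreover have "x \<in> Pi\<^sub>E I (restrict V I)" using V W(2) by (simp add: PiE_iff)
    moreover have "Pi\<^sub>E I (restrict V I) \<subseteq> Pi\<^sub>E I W" using V by (intro PiE_mono) simp
    then have "Pi\<^sub>E I (restrict V I) \<subseteq> U" using W(3) by (rule order_trans)
    ultimately show "\<exists>V\<in>Pi\<^sub>E I ` Pi\<^sub>E I \<B>. x \<in> V \<and> V \<subseteq> U" by blast
  qed
qed

lemma second_countable_product_topology:
  assumes "finite I" and "\<And>i. i \<in> I \<Longrightarrow> second_countable (X i)"
  shows "second_countable (product_topology X I)"
proof -
  have "\<forall>i\<in>I. second_countable (X i)" using assms(2) by blast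
  from second_countable_PiE_base[OF assms(1) this] obtain \<B> where \<B>: "countable \<B>"
    "\<forall>V\<in>\<B>. \<exists>U. (\<forall>i\<in>I. openin (X i) (U i)) \<and> V = Pi\<^sub>E I U"
    "\<forall>U x. openin (product_topology X I) U \<and> x \<in> U \<longrightarrow> (\<exists>V\<in>\<B>. x \<in> V \<and> V \<subseteq> U)"
    by (elim exE conjE)
  have "openin (product_topology X I) V" if V: "V \<in> \<B>" for V
  proof -
    obtain W where "\<forall>i\<in>I. openin (X i) (W i)" "V = Pi\<^sub>E I W" using \<B>(2) V by meson
    then show ?thesis using assms(1) by (simp add:openin_PiE_gen)
  qed
  then show ?thesis unfolding second_countable_def using \<B>(1,3) by (intro exI[of _ \<B>]) simp
qed

lemma openin_product_topology_sets_PiM: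
  assumes "finite I" and "\<And>i. i \<in> I \<Longrightarrow> second_countable (X i)"
    and "openin (product_topology X I) U"
  shows "U \<in> sets (PiM I (\<lambda>i. borel_of (X i)))"
proof -
  have "\<forall>i\<in>I. second_countable (X i)" using assms(2) by blast
  from second_countable_PiE_base[OF assms(1) this] obtain \<B> where \<B>: "countable \<B>"
    "\<forall>V\<in>\<B>. \<exists>U. (\<forall>i\<in>I. openin (X i) (U i)) \<and> V = Pi\<^sub>E I U"
    "\<forall>U x. openin (product_topology X I) U \<and> x \<in> U \<longrightarrow> (\<exists>V\<in>\<B>. x \<in> V \<and> V \<subseteq> U)"
    by (elim exE conjE)
  have "U = \<Union>{V\<in>\<B>. V \<subseteq> U}" using \<B>(3) assms(3) by fast
  moreover have "V \<in> sets (PiM I (\<lambda>i. borel_of (X i)))" if V: "V \<in> \<B>" for V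
  proof -
    obtain W where "\<forall>i\<in>I. openin (X i) (W i)" "V = Pi\<^sub>E I W" using \<B>(2) V by meson
    then show ?thesis using assms(1) by (simp add: sets_PiM_I_finite openin_sets_borel_of)
  qed
  then have "\<Union>{V\<in>\<B>. V \<subseteq> U} \<in> sets (PiM I (\<lambda>i. borel_of (X i)))"
    using \<B>(1) by (intro sets.countable_Union) auto
  ultimately show ?thesis by simp
qed

text \<open>By second countability every open set of the product is a countable union of boxes. The
  inclusion makes Borel sets of the product space measurable for the product measures.\<close>

lemma sets_borel_of_product_topology:
  assumes "finite I" and "\<And>i. i \<in> I \<Longrightarrow> second_countable (X i)"
  shows "sets (borel_of (product_topology X I)) \<subseteq> sets (PiM I (\<lambda>i. borel_of (X i)))"
proof -
  have "sigma_sets (space (PiM I (\<lambda>i. borel_of (X i)))) {U. openin (product_topology X I) U}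
      \<subseteq> sets (PiM I (\<lambda>i. borel_of (X i)))"
    by (intro sets.sigma_sets_subset) (auto intro: openin_product_topology_sets_PiM assms)
  then show ?thesis by (simp add: sets_borel_of space_PiM)
qed

lemma continuous_map_prod_measurable:
  assumes "second_countable X" "second_countable Y" "continuous_map (prod_topology X Y) Z f"
  shows "f \<in> borel_of X \<Otimes>\<^sub>M borel_of Y \<rightarrow>\<^sub>M borel_of Z"
proof (rule measurable_borel_ofI)
  show "f \<in> space (borel_of X \<Otimes>\<^sub>M borel_of Y) \<rightarrow> topspace Z"
    using assms(3) by (auto simp: space_pair_measure continuous_map_def)
  fix U assume "openin Z U"
  then have W: "openin (prod_topology X Y) {p \<in> topspace (prod_topology X Y). f p \<in> U}"
    (is "openin _ ?W") by (intro openin_continuous_map_preimage[OF assms(3)])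
  obtain \<A> where \<A>: "countable \<A>" "\<And>V. V \<in> \<A> \<Longrightarrow> openin X V"
    "\<And>U x. openin X U \<Longrightarrow> x \<in> U \<Longrightarrow> \<exists>V\<in>\<A>. x \<in> V \<and> V \<subseteq> U"
    using assms(1) unfolding second_countable_def by metis
  obtain \<B> where \<B>: "countable \<B>" "\<And>V. V \<in> \<B> \<Longrightarrow> openin Y V"
    "\<And>U x. openin Y U \<Longrightarrow> x \<in> U \<Longrightarrow> \<exists>V\<in>\<B>. x \<in> V \<and> V \<subseteq> U"
    using assms(2) unfolding second_countable_def by metis
  have "?W = (\<Union>p\<in>{p\<in>\<A> \<times> \<B>. fst p \<times> snd p \<subseteq> ?W}. fst p \<times> snd p)"
  proof (intro equalityI subsetI)
    fix q assume q: "q \<in> ?W"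
    obtain a b where ab: "q = (a, b)" by (cases q)
    obtain A B where "openin X A" "openin Y B" "a \<in> A" "b \<in> B" "A \<times> B \<subseteq> ?W"
      using W q unfolding openin_prod_topology_alt ab by meson
    moreover obtain A' where "A' \<in> \<A>" "a \<in> A'" "A' \<subseteq> A" using \<A>(3) calculation by meson
    moreover obtain B' where "B' \<in> \<B>" "b \<in> B'" "B' \<subseteq> B" using \<B>(3) calculation by meson
    ultimately have "(A', B') \<in> {p\<in>\<A> \<times> \<B>. fst p \<times> snd p \<subseteq> ?W}" "q \<in> A' \<times> B'"
      using ab by auto
    then show "q \<in> (\<Union>p\<in>{p\<in>\<A> \<times> \<B>. fst p \<times> snd p \<subseteq> ?W}. fst p \<times> snd p)" by force
  qed auto
  moreover have "(\<Union>p\<in>{p\<in>\<A> \<times> \<B>. fst p \<times> snd p \<subseteq> ?W}. fst p \<times> snd p)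
      \<in> sets (borel_of X \<Otimes>\<^sub>M borel_of Y)"
    using \<A>(1,2) \<B>(1,2)
    by (intro sets.countable_UN' countable_Collect)
       (auto intro!: pair_measureI openin_sets_borel_of)
  moreover have "f -` U \<inter> space (borel_of X \<Otimes>\<^sub>M borel_of Y) = ?W"
    by (auto simp: space_pair_measure)
  ultimately show "f -` U \<inter> space (borel_of X \<Otimes>\<^sub>M borel_of Y) \<in> sets (borel_of X \<Otimes>\<^sub>M borel_of Y)"
    by metis
qed

subsection \<open>Inner regularity of finite Borel measures on Polish spaces\<close>

text \<open>An error budget \<open>e\<close> is spread geometrically; with the exponent
  \<open>Suc n\<close> the series sums to exactly \<open>e\<close>.\<close>

lemma (in finite_measure) measure_UN_le_geometric:
  fixes A :: "nat \<Rightarrow> 'a set"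
  assumes "\<And>n. A n \<in> sets M" and "\<And>n. measure M (A n) \<le> e * (1/2) ^ Suc n"
  shows "measure M (\<Union>n. A n) \<le> e"
proof -
  have s: "(\<lambda>n. e * (1/2) ^ Suc n) sums e"
    using sums_mult[OF power_half_series, of e] by simp
  then have "summable (\<lambda>n. measure M (A n))"
    by (intro summable_comparison_test'[OF sums_summable[OF s], of 0]) (simp add: assms(2)[simplified])
  then have "measure M (\<Union>n. A n) \<le> (\<Sum>n. measure M (A n))"
    using assms(1) by (intro finite_measure_subadditive_countably) auto
  also have "\<dots> \<le> (\<Sum>n. e * (1/2) ^ Suc n)"
    using \<open>summable _\<close> s by (intro suminf_le assms(2)) (auto simp: sums_iff)
  finally show ?thesis using s by (simp add: sums_iff)
qed

lemma (in finite_measure) measure_Diff_incseq_less: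
  fixes A :: "nat \<Rightarrow> 'a set"
  assumes "range A \<subseteq> sets M" "incseq A" "B \<in> sets M" "(\<Union>n. A n) = B" "(0::real) < e"
  obtains n where "measure M (B - A n) < e"
proof -
  have "(\<lambda>n. measure M (A n)) \<longlonglongrightarrow> measure M B"
    using finite_Lim_measure_incseq[OF assms(1,2)] assms(4) by simp
  then obtain n where "measure M B - e < measure M (A n)"
    using assms(5) order_tendstoD(1)[of _ _ _ "measure M B - e"]
    by (metis (mono_tags, lifting) diff_less eventually_sequentially order_refl less_add_same_cancel1 diff_less_eq)
  moreover have "measure M (B - A n) = measure M B - measure M (A n)"
    using assms by (intro finite_measure_Diff) auto
  ultimately have "measure M (B - A n) < e" by simp
  then show thesis by (rule that)
qed

lemma (in finite_measure) measure_Diff_UN_less: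
  fixes A :: "nat \<Rightarrow> 'a set"
  assumes "\<And>n. A n \<in> sets M" "(0::real) < e"
  shows "\<exists>n. measure M ((\<Union>i. A i) - (\<Union>i<n. A i)) < e"
proof -
  have "(\<Union>n. \<Union>i<n. A i) = (\<Union>i. A i)" by blast
  moreover have "incseq (\<lambda>n. \<Union>i<n. A i)" by (rule incseq_SucI) (auto intro: less_SucI)
  moreover have "(\<Union>i<n. A i) \<in> sets M" for n using assms(1) by blast
  ultimately obtain n where "measure M ((\<Union>i. A i) - (\<Union>i<n. A i)) < e"
    using measure_Diff_incseq_less[of "\<lambda>n. \<Union>i<n. A i" "\<Union>i. A i" e] assms by blast
  then show ?thesis by blast
qed

text \<open>The sets that admit such a squeeze form a \<sigma>-algebra, which contains the open sets
  because these are F_sigma in a metrizable space.\<close>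

lemma borel_closed_open_approx:
  assumes Y: "metrizable_space Y" and M: "finite_measure M" "sets M = sets (borel_of Y)"
    and B: "B \<in> sets M" and e: "(0::real) < e"
  shows "\<exists>F U. closedin Y F \<and> openin Y U \<and> F \<subseteq> B \<and> B \<subseteq> U \<and> measure M (U - F) < e"
proof -
  interpret finite_measure M by fact
  have op: "openin Y U \<Longrightarrow> U \<in> sets M" and cl: "closedin Y F \<Longrightarrow> F \<in> sets M" for U F
    using M(2) by (auto intro: openin_sets_borel_of closedin_sets_borel_of)
  have "B \<in> sigma_sets (topspace Y) {U. openin Y U}" using B M(2) by (simp add: sets_borel_of)
  then show ?thesis using e
  proof (induction arbitrary: e rule: sigma_sets.induct)
    case (Basic U)
    then have U: "openin Y U" by simp
    then obtain C where C: "\<And>n::nat. closedin Y (C n)" "\<And>n. C n \<subseteq> C (Suc n)" "\<Union>(range C) = U"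
      using open_imp_fsigma_in[OF Y] unfolding fsigma_in_ascending by metis
    have "incseq C" using C(2) by (rule incseq_SucI)
    obtain n where "measure M (U - C n) < e"
      by (rule measure_Diff_incseq_less[of C U e])
        (use C(1,3) U Basic.prems op cl \<open>incseq C\<close> in auto)
    then show ?case using U C by (intro exI[of _ "C n"] exI[of _ U]) auto
  next
    case Empty
    then show ?case by (intro exI[of _ "{}"]) auto
  next
    case (Compl A)
    from Compl.IH[OF Compl.prems] obtain F U where
      FU: "closedin Y F" "openin Y U" "F \<subseteq> A" "A \<subseteq> U" "measure M (U - F) < e" by blast
    have "(topspace Y - F) - (topspace Y - U) = U - F"
      using openin_subset[OF FU(2)] by auto
    then show ?case
      using FU by (intro exI[of _ "topspace Y - U"] exI[of _ "topspace Y - F"]) auto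
  next
    case (Union A)
    \<comment> \<open>An infinite union of closed sets need not be closed. Half of \<open>e\<close>
      pays for the gaps between the \<open>F n\<close> and the \<open>U n\<close>, the other half
      for truncating the union of the \<open>F n\<close>.\<close>
    have "\<exists>F U. closedin Y F \<and> openin Y U \<and> F \<subseteq> A n \<and> A n \<subseteq> U
        \<and> measure M (U - F) < e/2 * (1/2) ^ Suc n" for n
      using Union.prems by (intro Union.IH) simp
    then obtain F U where FU: "\<And>n. closedin Y (F n)" "\<And>n. openin Y (U n)"
      "\<And>n. F n \<subseteq> A n" "\<And>n. A n \<subseteq> U n" "\<And>n. measure M (U n - F n) < e/2 * (1/2) ^ Suc n"
      by metis
    have m: "F n \<in> sets M" "U n \<in> sets M" for n using op cl FU by auto
    obtain n where n: "measure M ((\<Union>n. F n) - (\<Union>i<n. F i)) < e/2"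
      using measure_Diff_UN_less[of F "e/2"] m Union.prems by auto
    have "measure M (\<Union>n. U n - F n) \<le> e/2"
      using FU(5) m by (intro measure_UN_le_geometric) (auto intro: less_imp_le)
    have "measure M ((\<Union>n. U n) - (\<Union>i<n. F i))
        \<le> measure M ((\<Union>n. U n - F n) \<union> ((\<Union>n. F n) - (\<Union>i<n. F i)))"
      using m by (intro finite_measure_mono) auto
    also have "\<dots> \<le> measure M (\<Union>n. U n - F n) + measure M ((\<Union>n. F n) - (\<Union>i<n. F i))"
      using m by (intro measure_Un_le) auto
    also have "\<dots> < e" using n \<open>measure M (\<Union>n. U n - F n) \<le> e/2\<close> by simp
    finally have "measure M ((\<Union>n. U n) - (\<Union>i<n. F i)) < e" .
    moreover have "closedin Y (\<Union>i<n. F i)" using FU(1) by (intro closedin_Union) auto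
    moreover have "openin Y (\<Union>n. U n)" using FU(2) by (intro openin_Union) auto
    moreover have "(\<Union>i<n. F i) \<subseteq> (\<Union>n. A n)" using FU(3) by (meson UN_mono subset_UNIV)
    moreover have "(\<Union>n. A n) \<subseteq> (\<Union>n. U n)" using FU(4) by (meson UN_mono subset_UNIV)
    ultimately show ?case by blast
  qed
qed

text \<open>Ulam's theorem: at each scale \<open>1 / Suc n\<close> finitely many closed balls around
  a dense sequence cover all but a geometrically small part. The intersection over all scales is
  closed and totally bounded, hence compact by completeness.\<close>

lemma polish_tight:
  assumes Y: "polish_topology Y" and M: "finite_measure M" "sets M = sets (borel_of Y)"
    and e: "(0::real) < e"
  shows "\<exists>K. compactin Y K \<and> measure M (space M - K) < e"
proof (cases "topspace Y = {}")
  case True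
  then have "space M = {}" using sets_eq_imp_space_eq[OF M(2)] by simp
  then show ?thesis using e by (intro exI[of _ "{}"]) simp
next
  case False
  interpret finite_measure M by fact
  have sp: "space M = topspace Y" using sets_eq_imp_space_eq[OF M(2)] by simp
  have cl: "closedin Y F \<Longrightarrow> F \<in> sets M" for F
    using M(2) by (auto intro: closedin_sets_borel_of)
  obtain S d where S: "Metric_space S d" "Metric_space.mcomplete S d" "Y = Metric_space.mtopology S d"
    using Y unfolding polish_topology_def completely_metrizable_space_def by blast
  interpret Metric_space S d by (rule S(1))
  obtain D where D: "countable D" "D \<subseteq> S" "mtopology closure_of D = S"
    using Y S(3) second_countable_imp_separable_space[of Y]
    unfolding polish_topology_def separable_space_def by auto
  then have "D \<noteq> {}" using False S(3) by auto
  then obtain x :: "nat \<Rightarrow> _" where x: "range x = D" using D(1) by (metis range_from_nat_into)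
  have xS: "x i \<in> S" for i using x D(2) by auto
  have cover: "(\<Union>i. mcball (x i) r) = S" if "0 < r" for r
  proof (intro equalityI subsetI)
    fix y assume "y \<in> S"
    then have "\<exists>z\<in>D. z \<in> mball y r"
      using D(3)[unfolded metric_closure_of] that by blast
    then obtain z where "z \<in> D" "z \<in> mball y r" by blast
    then obtain i where "z = x i" using x by (metis rangeE)
    then have "y \<in> mcball (x i) r"
      using \<open>z \<in> mball y r\<close> by (simp add: in_mball in_mcball commute less_imp_le)
    then show "y \<in> (\<Union>i. mcball (x i) r)" by blast
  qed auto
  have "\<exists>k. measure M (S - (\<Union>i<k. mcball (x i) (1/Suc n))) < e/2 * (1/2) ^ Suc n" for n
  proof -
    have m: "mcball (x i) r \<in> sets M" for i r using cl S(3) by simp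
    have "\<exists>k. measure M ((\<Union>i. mcball (x i) (1/Suc n)) - (\<Union>i<k. mcball (x i) (1/Suc n)))
        < e/2 * (1/2) ^ Suc n"
      using m e by (intro measure_Diff_UN_less) simp_all
    then show ?thesis using cover[of "1/Suc n"] by simp
  qed
  then obtain k where
    k: "\<And>n. measure M (S - (\<Union>i<k n. mcball (x i) (1/Suc n))) < e/2 * (1/2) ^ Suc n" by metis
  define K where "K = (\<Inter>n. \<Union>i<k n. mcball (x i) (1/Suc n))"
  have closed: "closedin mtopology (\<Union>i<k n. mcball (x i) (1/Suc n))" for n
    by (intro closedin_Union) auto
  then have K: "closedin mtopology K" unfolding K_def by (intro closedin_INT) auto
  have "mtotally_bounded K"
    unfolding mtotally_bounded_def
  proof (intro allI impI)
    fix r :: real assume "0 < r"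
    \<comment> \<open>Total boundedness asks for centres inside \<open>K\<close>. Replacing a centre
      \<open>x i\<close> by a point \<open>y i\<close> of \<open>K\<close> in the same ball doubles
      the radius, whence \<open>r / 2\<close>.\<close>
    then obtain n where n: "1 / Suc n < r / 2" by (meson half_gt_zero nat_approx_posE)
    define J where "J = {i. i < k n \<and> K \<inter> mcball (x i) (1/Suc n) \<noteq> {}}"
    have "\<forall>i\<in>J. \<exists>y. y \<in> K \<inter> mcball (x i) (1/Suc n)" unfolding J_def by blast
    then obtain y where y: "\<And>i. i \<in> J \<Longrightarrow> y i \<in> K \<inter> mcball (x i) (1/Suc n)" by metis
    have "K \<subseteq> (\<Union>z\<in>y ` J. mball z r)"
    proof
      fix z assume z: "z \<in> K"
      then obtain i where i: "i < k n" "z \<in> mcball (x i) (1/Suc n)" unfolding K_def by blast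
      then have "i \<in> J" using z unfolding J_def by blast
      from y[OF this] have "d (x i) (y i) \<le> 1/Suc n" "y i \<in> S" "z \<in> S" "d (x i) z \<le> 1/Suc n"
        using i(2) by (simp_all add: in_mcball)
      moreover from this have "d (y i) z \<le> d (x i) (y i) + d (x i) z"
        using xS[of i] triangle''[of "y i" "x i" z] by (simp add: commute)
      ultimately have "z \<in> mball (y i) r" using n by (simp add: in_mball)
      then show "z \<in> (\<Union>z\<in>y ` J. mball z r)" using \<open>i \<in> J\<close> by blast
    qed
    moreover have "finite J" unfolding J_def by simp
    ultimately show "\<exists>L. finite L \<and> L \<subseteq> K \<and> K \<subseteq> (\<Union>z\<in>L. mball z r)"
      using y by (intro exI[of _ "y ` J"] conjI finite_imageI image_subsetI) auto
  qed
  then have "compactin mtopology K"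
    using mtotally_bounded_eq_compact_closure_of[OF S(2)] K closure_of_closedin by metis
  moreover have "measure M (\<Union>n. S - (\<Union>i<k n. mcball (x i) (1/Suc n))) \<le> e/2"
  proof (rule measure_UN_le_geometric)
    fix n
    show "S - (\<Union>i<k n. mcball (x i) (1/Suc n)) \<in> sets M"
      using cl[unfolded S(3), OF closed] sets.top[of M] sp S(3) by auto
    show "measure M (S - (\<Union>i<k n. mcball (x i) (1/Suc n))) \<le> e/2 * (1/2) ^ Suc n"
      using k[of n] by (rule less_imp_le)
  qed
  moreover have "space M - K = (\<Union>n. S - (\<Union>i<k n. mcball (x i) (1/Suc n)))"
    unfolding K_def using sp S(3) by auto
  ultimately show ?thesis using e S(3) by (intro exI[of _ K]) simp
qed

text \<open>A closed set that fills most of \<open>B\<close>, intersected with a compact set that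
  fills most of the space, is compact and still fills most of \<open>B\<close>.\<close>

lemma polish_inner_regular:
  assumes Y: "polish_topology Y" and M: "finite_measure M" "sets M = sets (borel_of Y)"
    and B: "B \<in> sets M" and e: "(0::real) < e"
  shows "\<exists>C. compactin Y C \<and> C \<subseteq> B \<and> measure M (B - C) < e"
proof -
  interpret finite_measure M by fact
  have met: "metrizable_space Y"
    using Y by (simp add: polish_topology_def completely_metrizable_imp_metrizable_space)
  have cl: "closedin Y F \<Longrightarrow> F \<in> sets M" for F
    using M(2) by (auto intro: closedin_sets_borel_of)
  obtain F U where F: "closedin Y F" "openin Y U" "F \<subseteq> B" "B \<subseteq> U" "measure M (U - F) < e/2"
    using borel_closed_open_approx[OF met M B, of "e/2"] e by auto
  obtain K where K: "compactin Y K" "measure M (space M - K) < e/2"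
    using polish_tight[OF Y M, of "e/2"] e by auto
  have KM: "K \<in> sets M"
    using cl compactin_imp_closedin metrizable_imp_Hausdorff_space met K(1) by blast
  have m: "U - F \<in> sets M" "space M - K \<in> sets M"
    using F(1,2) KM cl M(2) by (auto intro: openin_sets_borel_of)
  have "measure M (B - (F \<inter> K)) \<le> measure M ((U - F) \<union> (space M - K))"
    using F(4) m sets.sets_into_space[OF B] by (intro finite_measure_mono) auto
  also have "\<dots> \<le> measure M (U - F) + measure M (space M - K)"
    using m by (rule measure_Un_le)
  also have "\<dots> < e" using F(5) K(2) by simp
  finally show ?thesis
    using F K(1) by (intro exI[of _ "F \<inter> K"]) (auto intro: closed_Int_compactin)
qed

lemma polish_sigma_compactin_conull:
  assumes Y: "polish_topology Y" and M: "finite_measure M" "sets M = sets (borel_of Y)"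
    and B: "B \<in> sets M"
  shows "\<exists>S. sigma_compactin Y S \<and> S \<subseteq> B \<and> measure M (B - S) = 0"
proof -
  interpret finite_measure M by fact
  have "\<exists>C. compactin Y C \<and> C \<subseteq> B \<and> measure M (B - C) < 1 / real (Suc n)" for n
    by (rule polish_inner_regular[OF Y M B]) simp
  then obtain C where C: "\<And>n. compactin Y (C n)" "\<And>n. C n \<subseteq> B"
    "\<And>n. measure M (B - C n) < 1 / real (Suc n)" by metis
  have S: "sigma_compactin Y (\<Union>n. C n)"
    using C(1) by (intro sigma_compactin_UN compactin_imp_sigma_compactin) simp_all
  have H: "Hausdorff_space Y"
    using Y by (simp add: polish_topology_def completely_metrizable_imp_metrizable_space
        metrizable_imp_Hausdorff_space)
  have CM: "C n \<in> sets M" for n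
    unfolding M(2) by (intro sigma_compactin_sets_borel_of H compactin_imp_sigma_compactin C(1))
  have "measure M (B - (\<Union>n. C n)) \<le> 1 / real (Suc n)" for n
  proof -
    have "measure M (B - (\<Union>n. C n)) \<le> measure M (B - C n)"
      using B CM by (intro finite_measure_mono) auto
    then show ?thesis using C(3)[of n] by linarith
  qed
  note bound = this
  have "measure M (B - (\<Union>n. C n)) \<le> 0 + e" if e: "0 < e" for e
  proof -
    obtain n where "1 / real (Suc n) < e" using nat_approx_posE[OF e] by blast
    then show ?thesis using bound[of n] by linarith
  qed
  then have "measure M (B - (\<Union>n. C n)) \<le> 0" by (rule field_le_epsilon)
  then have "measure M (B - (\<Union>n. C n)) = 0" by (simp add: measure_le_0_iff)
  then show ?thesis using S C(2) by (intro exI[of _ "\<Union>n. C n"] conjI UN_least)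
qed

subsection \<open>Finite product measures\<close>

text \<open>By Fubini the factors can be enlarged one at a time. Integrals are compared, and not
  just measures of sets, because the induction hypothesis is applied to an inner integral, which is
  no longer an indicator.\<close>

lemma nn_integral_PiM_mono_measure:
  assumes "finite I"
    and M: "\<And>i. finite_measure (M i)" and N: "\<And>i. finite_measure (N i)"
    and sets: "\<And>i. sets (M i) = sets (N i)" and le: "\<And>i. M i \<le> N i"
    and f: "f \<in> borel_measurable (PiM I N)"
  shows "(\<integral>\<^sup>+ x. f x \<partial>PiM I M) \<le> (\<integral>\<^sup>+ x. f x \<partial>PiM I N)"
  using assms(1) f
proof (induction I arbitrary: f rule: finite_induct)
  case empty
  show ?case by (simp add: PiM_empty)
next
  case (insert i I)
  interpret M: product_sigma_finite M
    using M by (simp add: product_sigma_finite_def finite_measure.axioms(1))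
  interpret N: product_sigma_finite N
    using N by (simp add: product_sigma_finite_def finite_measure.axioms(1))
  have sPi: "sets (PiM J M) = sets (PiM J N)" for J by (intro sets_PiM_cong sets refl)
  have fM: "f \<in> borel_measurable (PiM (insert i I) M)"
    using insert.prems by (simp cong: measurable_cong_sets add: measurable_cong_sets[OF sPi refl])
  have upd: "(\<lambda>(x, y). f (x(i := y))) \<in> borel_measurable (PiM I N \<Otimes>\<^sub>M N i)"
    using measurable_comp[OF measurable_add_dim insert.prems] by (simp add: comp_def split_beta')
  have "(\<integral>\<^sup>+ x. f x \<partial>PiM (insert i I) M) = (\<integral>\<^sup>+ x. \<integral>\<^sup>+ y. f (x(i := y)) \<partial>M i \<partial>PiM I M)"
    by (intro M.product_nn_integral_insert insert.hyps fM)
  also have "\<dots> \<le> (\<integral>\<^sup>+ x. \<integral>\<^sup>+ y. f (x(i := y)) \<partial>N i \<partial>PiM I M)"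
    by (intro nn_integral_mono nn_integral_mono_measure sets le)
  also have "\<dots> \<le> (\<integral>\<^sup>+ x. \<integral>\<^sup>+ y. f (x(i := y)) \<partial>N i \<partial>PiM I N)"
    using upd by (intro insert.IH N.borel_measurable_nn_integral)
  also have "\<dots> = (\<integral>\<^sup>+ x. f x \<partial>PiM (insert i I) N)"
    by (intro N.product_nn_integral_insert[symmetric] insert.hyps insert.prems)
  finally show ?case .
qed

lemma emeasure_PiM_mono_measure:
  assumes "finite I"
    and "\<And>i. finite_measure (M i)" and "\<And>i. finite_measure (N i)"
    and sets: "\<And>i. sets (M i) = sets (N i)" and "\<And>i. M i \<le> N i"
    and S: "S \<in> sets (PiM I N)"
  shows "emeasure (PiM I M) S \<le> emeasure (PiM I N) S"
proof -
  have "sets (PiM I M) = sets (PiM I N)" by (intro sets_PiM_cong sets refl)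
  then show ?thesis
    using nn_integral_PiM_mono_measure[of I M N "indicator S"] assms by simp
qed

lemma measurable_PiM_map:
  assumes "\<And>i. i \<in> I \<Longrightarrow> f i \<in> M i \<rightarrow>\<^sub>M N i"
  shows "(\<lambda>x. \<lambda>i\<in>I. f i (x i)) \<in> PiM I M \<rightarrow>\<^sub>M PiM I N"
proof (rule measurable_restrict)
  fix i assume i: "i \<in> I"
  show "(\<lambda>x. f i (x i)) \<in> PiM I M \<rightarrow>\<^sub>M N i"
    using measurable_compose[OF measurable_component_singleton[OF i, of M] assms[OF i]] .
qed

text \<open>Both sides agree on boxes, and product measures are unique. The factors are finite
  rather than \<sigma>-finite because an image measure inherits finiteness but not
  \<sigma>-finiteness.\<close>

lemma distr_PiM:
  fixes M :: "'i \<Rightarrow> 'a measure" and N :: "'i \<Rightarrow> 'b measure"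
  assumes I: "finite I" and M: "\<And>i. finite_measure (M i)"
    and f: "\<And>i. f i \<in> M i \<rightarrow>\<^sub>M N i"
  shows "distr (PiM I M) (PiM I N) (\<lambda>x. \<lambda>i\<in>I. f i (x i)) = PiM I (\<lambda>i. distr (M i) (N i) (f i))"
proof -
  interpret M: product_sigma_finite M
    using M by (simp add: product_sigma_finite_def finite_measure.axioms(1))
  interpret D: product_sigma_finite "\<lambda>i. distr (M i) (N i) (f i)"
    unfolding product_sigma_finite_def
    by (intro allI finite_measure.axioms(1) finite_measure.finite_measure_distr M f)
  have meas: "(\<lambda>x. \<lambda>i\<in>I. f i (x i)) \<in> PiM I M \<rightarrow>\<^sub>M PiM I N"
    by (intro measurable_PiM_map f)
  show ?thesis
  proof (rule D.PiM_eqI[OF I])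
    show "sets (distr (PiM I M) (PiM I N) (\<lambda>x. \<lambda>i\<in>I. f i (x i)))
        = sets (PiM I (\<lambda>i. distr (M i) (N i) (f i)))"
      unfolding sets_distr by (intro sets_PiM_cong) simp_all
    fix A assume A: "\<And>i. i \<in> I \<Longrightarrow> A i \<in> sets (distr (M i) (N i) (f i))"
    then have A': "\<And>i. i \<in> I \<Longrightarrow> A i \<in> sets (N i)" by simp
    have fA: "\<And>i. i \<in> I \<Longrightarrow> f i -` A i \<inter> space (M i) \<in> sets (M i)"
      using A' f by (intro measurable_sets)
    have "(\<lambda>x. \<lambda>i\<in>I. f i (x i)) -` Pi\<^sub>E I A \<inter> space (PiM I M) = Pi\<^sub>E I (\<lambda>i. f i -` A i \<inter> space (M i))"
      by (auto simp: space_PiM PiE_iff)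
    then have "emeasure (distr (PiM I M) (PiM I N) (\<lambda>x. \<lambda>i\<in>I. f i (x i))) (Pi\<^sub>E I A)
        = emeasure (PiM I M) (Pi\<^sub>E I (\<lambda>i. f i -` A i \<inter> space (M i)))"
      using A' I meas by (subst emeasure_distr) (auto intro: sets_PiM_I_finite)
    also have "\<dots> = (\<Prod>i\<in>I. emeasure (M i) (f i -` A i \<inter> space (M i)))"
      by (intro M.emeasure_PiM I fA)
    also have "\<dots> = (\<Prod>i\<in>I. emeasure (distr (M i) (N i) (f i)) (A i))"
      using A' f by (intro prod.cong refl) (simp add: emeasure_distr)
    finally show "emeasure (distr (PiM I M) (PiM I N) (\<lambda>x. \<lambda>i\<in>I. f i (x i))) (Pi\<^sub>E I A)
        = (\<Prod>i\<in>I. emeasure (distr (M i) (N i) (f i)) (A i))" .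
  qed
qed

lemma PiM_scale_measure:
  assumes I: "finite I" and M: "\<And>i. finite_measure (M i)" and c: "\<And>i. c i < \<infinity>"
  shows "scale_measure (\<Prod>i\<in>I. c i) (PiM I M) = PiM I (\<lambda>i. scale_measure (c i) (M i))"
proof -
  interpret M: product_sigma_finite M
    using M by (simp add: product_sigma_finite_def finite_measure.axioms(1))
  have "finite_measure (scale_measure (c i) (M i))" for i
    using finite_measure.emeasure_finite[OF M[of i]] c[of i]
    by (intro finite_measureI) (simp add: ennreal_mult_eq_top_iff less_top)
  then interpret S: product_sigma_finite "\<lambda>i. scale_measure (c i) (M i)"
    by (simp add: product_sigma_finite_def finite_measure.axioms(1))
  show ?thesis
  proof (rule S.PiM_eqI[OF I])
    show "sets (scale_measure (\<Prod>i\<in>I. c i) (PiM I M)) = sets (PiM I (\<lambda>i. scale_measure (c i) (M i)))"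
      unfolding sets_scale_measure by (intro sets_PiM_cong) simp_all
    fix A assume "\<And>i. i \<in> I \<Longrightarrow> A i \<in> sets (scale_measure (c i) (M i))"
    then show "emeasure (scale_measure (\<Prod>i\<in>I. c i) (PiM I M)) (Pi\<^sub>E I A)
        = (\<Prod>i\<in>I. emeasure (scale_measure (c i) (M i)) (A i))"
      using I by (simp add: M.emeasure_PiM prod.distrib)
  qed
qed

text \<open>The product is taken over the pairs \<open>\<alpha> i \<Otimes>\<^sub>M \<nu> i\<close>,
  so that the projections to \<open>\<nu> i\<close> and the maps \<open>a i\<close> both act
  coordinatewise and \<open>distr_PiM\<close> applies to each. In this one space the preimage of
  \<open>B\<close> has the mass on the left and lies in the preimage of \<open>S\<close>. The
  measurable \<open>S\<close> stands in for the image, which need not be measurable.\<close>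

lemma PiM_pushforward_bound:
  fixes \<alpha> :: "'i::finite \<Rightarrow> 'a measure" and \<nu> :: "'i \<Rightarrow> 'b measure" and \<mu> :: "'i \<Rightarrow> 'c measure"
  assumes \<alpha>: "\<And>i. finite_measure (\<alpha> i)" and \<nu>: "\<And>i. finite_measure (\<nu> i)"
    and \<mu>: "\<And>i. finite_measure (\<mu> i)"
    and a: "\<And>i. a i \<in> \<alpha> i \<Otimes>\<^sub>M \<nu> i \<rightarrow>\<^sub>M \<mu> i"
    and le: "\<And>i. distr (\<alpha> i \<Otimes>\<^sub>M \<nu> i) (\<mu> i) (a i) \<le> \<mu> i"
    and B: "B \<in> sets (PiM UNIV \<nu>)" and S: "S \<in> sets (PiM UNIV \<mu>)"
    and sub: "\<And>h z. h \<in> space (PiM UNIV \<alpha>) \<Longrightarrow> z \<in> B \<Longrightarrow> (\<lambda>i. a i (h i, z i)) \<in> S"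
  shows "(\<Prod>i\<in>UNIV. emeasure (\<alpha> i) (space (\<alpha> i))) * emeasure (PiM UNIV \<nu>) B \<le> emeasure (PiM UNIV \<mu>) S"
proof -
  let ?\<rho> = "\<lambda>i. \<alpha> i \<Otimes>\<^sub>M \<nu> i"
  have \<rho>: "finite_measure (?\<rho> i)" for i by (intro finite_measure_pair_measure \<alpha> \<nu>)
  have snd: "distr (?\<rho> i) (\<nu> i) snd = scale_measure (emeasure (\<alpha> i) (space (\<alpha> i))) (\<nu> i)" for i
  proof (rule measure_eqI)
    interpret sigma_finite_measure "\<nu> i" using \<nu> by (rule finite_measure.axioms(1))
    fix A assume "A \<in> sets (distr (?\<rho> i) (\<nu> i) snd)"
    then have A: "A \<in> sets (\<nu> i)" by simp
    then have "snd -` A \<inter> space (?\<rho> i) = space (\<alpha> i) \<times> A"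
      using sets.sets_into_space[OF A] by (auto simp: space_pair_measure)
    then show "emeasure (distr (?\<rho> i) (\<nu> i) snd) A
        = emeasure (scale_measure (emeasure (\<alpha> i) (space (\<alpha> i))) (\<nu> i)) A"
      using A by (simp add: emeasure_distr emeasure_pair_measure_Times)
  qed simp
  have fin: "emeasure (\<alpha> i) (space (\<alpha> i)) < \<infinity>" for i
    using finite_measure.emeasure_finite[OF \<alpha>] by (simp add: less_top)
  have "(\<Prod>i\<in>UNIV. emeasure (\<alpha> i) (space (\<alpha> i))) * emeasure (PiM UNIV \<nu>) B
      = emeasure (PiM UNIV (\<lambda>i. distr (?\<rho> i) (\<nu> i) snd)) B"
    unfolding snd PiM_scale_measure[OF finite_class.finite_UNIV \<nu> fin, symmetric] by simp
  also have "\<dots> = emeasure (distr (PiM UNIV ?\<rho>) (PiM UNIV \<nu>) (\<lambda>x. \<lambda>i\<in>UNIV. snd (x i))) B"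
    by (subst distr_PiM[OF _ \<rho>]) simp_all
  also have "\<dots> = emeasure (PiM UNIV ?\<rho>) ((\<lambda>x. \<lambda>i\<in>UNIV. snd (x i)) -` B \<inter> space (PiM UNIV ?\<rho>))"
    by (intro emeasure_distr B measurable_PiM_map measurable_snd)
  also have "\<dots> \<le> emeasure (PiM UNIV ?\<rho>) ((\<lambda>x. \<lambda>i\<in>UNIV. a i (x i)) -` S \<inter> space (PiM UNIV ?\<rho>))"
  proof (rule emeasure_mono)
    have "(\<lambda>x. \<lambda>i\<in>UNIV. a i (x i)) \<in> PiM UNIV ?\<rho> \<rightarrow>\<^sub>M PiM UNIV \<mu>"
      by (intro measurable_PiM_map a)
    then show "(\<lambda>x. \<lambda>i\<in>UNIV. a i (x i)) -` S \<inter> space (PiM UNIV ?\<rho>) \<in> sets (PiM UNIV ?\<rho>)"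
      using S by (rule measurable_sets)
    show "(\<lambda>x. \<lambda>i\<in>UNIV. snd (x i)) -` B \<inter> space (PiM UNIV ?\<rho>)
        \<subseteq> (\<lambda>x. \<lambda>i\<in>UNIV. a i (x i)) -` S \<inter> space (PiM UNIV ?\<rho>)"
    proof
      fix x assume x: "x \<in> (\<lambda>x. \<lambda>i\<in>UNIV. snd (x i)) -` B \<inter> space (PiM UNIV ?\<rho>)"
      then have "(\<lambda>i. fst (x i)) \<in> space (PiM UNIV \<alpha>)"
        by (auto simp: space_PiM space_pair_measure PiE_iff mem_Times_iff)
      moreover have "(\<lambda>i. snd (x i)) \<in> B" using x by (simp add: restrict_UNIV)
      ultimately have "(\<lambda>i. a i (x i)) \<in> S" using sub by fastforce
      then show "x \<in> (\<lambda>x. \<lambda>i\<in>UNIV. a i (x i)) -` S \<inter> space (PiM UNIV ?\<rho>)"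
        using x by (simp add: restrict_UNIV)
    qed
  qed
  also have "\<dots> = emeasure (distr (PiM UNIV ?\<rho>) (PiM UNIV \<mu>) (\<lambda>x. \<lambda>i\<in>UNIV. a i (x i))) S"
    by (intro emeasure_distr[symmetric] S measurable_PiM_map a)
  also have "\<dots> = emeasure (PiM UNIV (\<lambda>i. distr (?\<rho> i) (\<mu> i) (a i))) S"
    by (subst distr_PiM[OF _ \<rho> a]) simp_all
  also have "\<dots> \<le> emeasure (PiM UNIV \<mu>) S"
    using S by (intro emeasure_PiM_mono_measure finite_measure.finite_measure_distr \<rho> a le \<mu>) simp_all
  finally show ?thesis .
qed

subsection \<open>Locally compact second countable groups\<close>

text \<open>Continuity at the identity. Both kinds of difference are controlled, as neither bound
  implies the other in a non-commutative group.\<close>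

lemma small_difference_neighbourhood:
  fixes E :: "'g::topological_group_add set"
  assumes "open E" "0 \<in> E"
  shows "\<exists>V. open V \<and> 0 \<in> V \<and> (\<forall>a\<in>V. \<forall>b\<in>V. - a + b \<in> E \<and> a - b \<in> E)"
proof -
  let ?F = "nhds (0::'g) \<times>\<^sub>F nhds (0::'g)"
  have lim: "(fst \<longlongrightarrow> 0) ?F" "(snd \<longlongrightarrow> 0) ?F"
    by (rule filterlim_fst, rule filterlim_snd)
  have "((\<lambda>p. - fst p + snd p) \<longlongrightarrow> - 0 + 0) ?F"
    by (rule tendsto_add[OF tendsto_minus[OF lim(1)] lim(2)])
  from topological_tendstoD[OF this assms(1)] have "eventually (\<lambda>p. - fst p + snd p \<in> E) ?F"
    using assms(2) by simp
  moreover have "((\<lambda>p. fst p + - snd p) \<longlongrightarrow> 0 + - 0) ?F"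
    by (rule tendsto_add[OF lim(1) tendsto_minus[OF lim(2)]])
  from topological_tendstoD[OF this assms(1)] have "eventually (\<lambda>p. fst p + - snd p \<in> E) ?F"
    using assms(2) by simp
  ultimately have "eventually (\<lambda>p. - fst p + snd p \<in> E \<and> fst p - snd p \<in> E) ?F"
    by (rule eventually_elim2) simp
  then obtain Q where Q: "eventually Q (nhds (0::'g))"
    "\<forall>a b. Q a \<longrightarrow> Q b \<longrightarrow> - a + b \<in> E \<and> a - b \<in> E"
    unfolding eventually_prod_same fst_conv snd_conv by (elim exE conjE)
  then obtain V where "open V" "0 \<in> V" "\<forall>a\<in>V. Q a" unfolding eventually_nhds by blast
  then show ?thesis using Q(2) by (intro exI[of _ V]) simp
qed

lemma Hausdorff_space_euclidean_t2: "Hausdorff_space (euclidean :: 'a::t2_space topology)"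
  unfolding Hausdorff_space_def disjnt_def by (simp add: separation_t2)

lemma compact_neighbourhood:
  fixes E :: "'a::t2_space set"
  assumes "locally_compact_space (euclidean :: 'a topology)" "open E" "x \<in> E"
  obtains W V where "open W" "x \<in> W" "W \<subseteq> V" "compact V" "V \<subseteq> E"
proof -
  have "neighbourhood_base_of (compactin euclidean) (euclidean :: 'a topology)"
    by (rule locally_compact_space_neighbourhood_base[THEN iffD1, OF disjI1 assms(1)])
      (rule Hausdorff_space_euclidean_t2)
  from this[unfolded neighbourhood_base_of, rule_format, of E x]
  have "\<exists>W V. openin euclidean W \<and> compactin euclidean V \<and> x \<in> W \<and> W \<subseteq> V \<and> V \<subseteq> E"
    using assms(2,3) by simp
  then show thesis using that by auto
qed

lemma countable_compact_cover:
  fixes E :: "'a::{second_countable_topology,t2_space} set"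
  assumes lc: "locally_compact_space (euclidean :: 'a topology)" and E: "open E"
  obtains \<W> where "countable \<W>" "\<And>W. W \<in> \<W> \<Longrightarrow> open W \<and> compact (closure W) \<and> closure W \<subseteq> E"
    "\<Union>\<W> = E"
proof -
  obtain B :: "'a set set" where B: "countable B" "topological_basis B"
    using ex_countable_basis by blast
  let ?W = "{W \<in> B. compact (closure W) \<and> closure W \<subseteq> E}"
  have "E \<subseteq> \<Union>?W"
  proof
    fix x assume "x \<in> E"
    then obtain W V where WV: "open W" "x \<in> W" "W \<subseteq> V" "compact V" "V \<subseteq> E"
      using compact_neighbourhood[OF lc E] by blast
    obtain b where b: "b \<in> B" "x \<in> b" "b \<subseteq> W"
      using topological_basisE[OF B(2) WV(1,2)] by blast
    have "closure b \<subseteq> V"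
      using b(3) WV(3,4) by (intro closure_minimal compact_imp_closed) auto
    then have "b \<in> ?W"
      using b(1) WV(4,5) closed_Int_compact[of "closure b" V] by (auto simp: Int_absorb2)
    then show "x \<in> \<Union>?W" using b(2) by blast
  qed
  moreover have "\<Union>?W \<subseteq> E" using closure_subset by blast
  ultimately show thesis
    using B by (intro that[of ?W]) (auto simp: topological_basis_open)
qed

lemma sigma_compactin_open:
  fixes E :: "'a::{second_countable_topology,t2_space} set"
  assumes "locally_compact_space (euclidean :: 'a topology)" "open E"
  shows "sigma_compactin euclidean E"
proof -
  obtain \<W> where W: "countable \<W>"
    "\<And>W. W \<in> \<W> \<Longrightarrow> open W \<and> compact (closure W) \<and> closure W \<subseteq> E" "\<Union>\<W> = E"
    by (rule countable_compact_cover[OF assms]) blast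
  have "E = (\<Union>W\<in>\<W>. closure W)" using W(2,3) closure_subset by blast
  moreover have "sigma_compactin euclidean (\<Union>W\<in>\<W>. closure W)"
    using W(1,2) by (intro sigma_compactin_UN compactin_imp_sigma_compactin) auto
  ultimately show ?thesis by simp
qed

text \<open>The sets \<open>L n\<close> are built from closures of open sets that cover the space,
  so a compact \<open>K\<close> is absorbed by a finite subcover. Leaving every compact set can then
  be tested on the \<open>L n\<close>.\<close>

lemma compact_exhaustion:
  assumes "locally_compact_space (euclidean :: 'a topology)"
  obtains L :: "nat \<Rightarrow> 'a::{second_countable_topology,t2_space} set" where "\<And>n. compact (L n)" "incseq L"
    "\<And>K. compact K \<Longrightarrow> \<exists>n. K \<subseteq> L n"
proof -
  obtain \<W> :: "'a set set" where W: "countable \<W>"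
    "\<And>W. W \<in> \<W> \<Longrightarrow> open W \<and> compact (closure W) \<and> closure W \<subseteq> UNIV" "\<Union>\<W> = UNIV"
    by (rule countable_compact_cover[OF assms open_UNIV]) blast
  have "\<W> \<noteq> {}" using W(3) by force
  then obtain w :: "nat \<Rightarrow> 'a set" where w: "range w = \<W>"
    using range_from_nat_into[OF _ W(1)] by blast
  then have "w i \<in> \<W>" for i by blast
  then have ow: "open (w i)" "compact (closure (w i))" for i using W(2) by simp_all
  show thesis
  proof (rule that[of "\<lambda>n. \<Union>i<n. closure (w i)"])
    show "compact (\<Union>i<n. closure (w i))" for n by (intro compact_UN ow(2)) simp
    show "incseq (\<lambda>n. \<Union>i<n. closure (w i))" by (rule incseq_SucI) (auto intro: less_SucI)
    fix K :: "'a set" assume K: "compact K"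
    have "K \<subseteq> (\<Union>i\<in>UNIV. w i)" using W(3) unfolding w by simp
    then have "\<exists>I. finite I \<and> K \<subseteq> (\<Union>i\<in>I. w i)"
      by (rule compactE_image[OF K ow(1)]) blast
    then obtain I where I: "finite I" "K \<subseteq> (\<Union>i\<in>I. w i)" by blast
    obtain n where "\<forall>i\<in>I. i < n" using I(1) finite_nat_set_iff_bounded by blast
    then have "(\<Union>i\<in>I. w i) \<subseteq> (\<Union>i<n. closure (w i))" by (intro UN_mono closure_subset) blast
    then have "K \<subseteq> (\<Union>i<n. closure (w i))" using I(2) by (rule order_trans[rotated])
    then show "\<exists>n. K \<subseteq> (\<Union>i<n. closure (w i))" by blast
  qed
qed

lemma continuous_on_translate:
  fixes c :: "'g::topological_monoid_add"
  shows "continuous_on S (\<lambda>h. c + h)" "continuous_on S (\<lambda>h. h + c)"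
  by (intro continuous_intros)+

lemma translate_image_eq_vimage:
  fixes c :: "'g::group_add"
  shows "(\<lambda>h. c + h) ` W = (\<lambda>h. - c + h) -` W" "(\<lambda>h. h + c) ` W = (\<lambda>h. h - c) -` W"
proof -
  have "x \<in> (\<lambda>h. c + h) ` W" if "- c + x \<in> W" for x
    using imageI[OF that, of "\<lambda>h. c + h"] by (simp add: add.assoc[symmetric])
  then show "(\<lambda>h. c + h) ` W = (\<lambda>h. - c + h) -` W" by (auto simp: add.assoc[symmetric])
  have "x \<in> (\<lambda>h. h + c) ` W" if "x - c \<in> W" for x
    using imageI[OF that, of "\<lambda>h. h + c"] by simp
  then show "(\<lambda>h. h + c) ` W = (\<lambda>h. h - c) -` W" by auto
qed

lemma open_translate:
  fixes c :: "'g::topological_group_add"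
  assumes "open W"
  shows "open ((\<lambda>h. c + h) ` W)" "open ((\<lambda>h. h + c) ` W)"
  unfolding translate_image_eq_vimage
  using assms continuous_on_translate(1)[of UNIV "- c"] continuous_on_translate(2)[of UNIV "- c"]
  by (auto intro: open_vimage)

lemma compact_translate:
  fixes c :: "'g::topological_group_add"
  assumes "compact W"
  shows "compact ((\<lambda>h. c + h) ` W)" "compact ((\<lambda>h. h + c) ` W)"
  using assms by (auto intro: compact_continuous_image continuous_on_translate)

lemma left_translate_emeasure:
  fixes m :: "'g::{topological_group_add, second_countable_topology, t2_space} measure"
  assumes m: "left_haar_measure m" and A: "A \<in> sets borel"
  shows "emeasure m ((\<lambda>h. c + h) ` A) = emeasure m A"
proof -
  have s: "sets m = sets borel" and "distr m borel (\<lambda>h. - c + h) = m"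
    using m by (auto simp: left_haar_measure_def)
  then have "emeasure m A = emeasure m ((\<lambda>h. - c + h) -` A \<inter> space m)"
    using A borel_measurable_continuous_onI[OF continuous_on_translate(1), of "- c"]
      emeasure_distr[of "\<lambda>h. - c + h" m borel A]
    by (simp add: measurable_cong_sets[OF s refl])
  also have "(\<lambda>h. - c + h) -` A \<inter> space m = (\<lambda>h. c + h) ` A"
    using sets_eq_imp_space_eq[OF s] by (simp add: translate_image_eq_vimage)
  finally show ?thesis by simp
qed

text \<open>This is where unimodularity enters: in general a right translation rescales a left Haar
  measure.\<close>

lemma right_translate_emeasure:
  fixes m :: "'g::{topological_group_add, second_countable_topology, t2_space} measure"
  assumes "unimodular TYPE('g)" and m: "left_haar_measure m" and A: "A \<in> sets borel"
  shows "emeasure m ((\<lambda>h. h + c) ` A) = emeasure m A"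
proof -
  have s: "sets m = sets borel" using m unfolding left_haar_measure_def by (rule conjunct1)
  have "distr m borel (\<lambda>h. h + - c) = m"
    using assms(1)[unfolded unimodular_def, rule_format, OF m] .
  then have "emeasure m A = emeasure m ((\<lambda>h. h + - c) -` A \<inter> space m)"
    using A borel_measurable_continuous_onI[OF continuous_on_translate(2), of "- c"]
      emeasure_distr[of "\<lambda>h. h + - c" m borel A]
    by (simp add: measurable_cong_sets[OF s refl])
  also have "(\<lambda>h. h + - c) -` A \<inter> space m = (\<lambda>h. h + c) ` A"
    using sets_eq_imp_space_eq[OF s] by (simp add: translate_image_eq_vimage)
  finally show ?thesis by simp
qed

text \<open>By Lindelof countably many left translates of \<open>W\<close> cover the group; if
  \<open>W\<close> were null, so would be the group.\<close>

lemma left_haar_measure_open_pos: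
  fixes m :: "'g::{topological_group_add, second_countable_topology, t2_space} measure"
  assumes m: "left_haar_measure m" and W: "open W" "0 \<in> W"
  shows "emeasure m W > 0"
proof (rule ccontr)
  assume "\<not> emeasure m W > 0"
  then have 0: "emeasure m W = 0" by simp
  have s: "sets m = sets borel" using m by (simp add: left_haar_measure_def)
  obtain \<F> where F: "\<F> \<subseteq> range (\<lambda>c. (\<lambda>h. c + h) ` W)" "countable \<F>"
    "\<Union>\<F> = (\<Union>c. (\<lambda>h. c + h) ` W)"
    using Lindelof[of "range (\<lambda>c. (\<lambda>h. c + h) ` W)"] open_translate(1)[OF W(1)] by blast
  have "S \<in> null_sets m" if S: "S \<in> \<F>" for S
  proof -
    obtain c where "S = (\<lambda>h. c + h) ` W" using S F(1) by blast
    then show ?thesis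
      using 0 W(1) left_translate_emeasure[OF m, of W c] open_translate(1)[OF W(1), of c] s
      by (intro null_setsI) simp_all
  qed
  then have "(\<Union>S\<in>\<F>. S) \<in> null_sets m" using F(2) by (intro null_sets_UN') auto
  moreover have "x \<in> (\<Union>c. (\<lambda>h. c + h) ` W)" for x
    using imageI[OF W(2), of "\<lambda>h. x + h"] by auto
  then have "(\<Union>S\<in>\<F>. S) = UNIV" using F(3) by auto
  ultimately show False using m by (simp add: left_haar_measure_def null_sets_def)
qed

text \<open>Greedy choice: the \<open>x\<close> for which \<open>V + x\<close> meets one of the
  earlier translates form a compact set, which cannot be the whole group.\<close>

lemma disjoint_translates:
  fixes V :: "'g::{topological_group_add, t2_space} set"
  assumes V: "compact V" and nc: "\<not> compact (UNIV :: 'g set)"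
  shows "\<exists>F. finite F \<and> card F = N \<and>
    (\<forall>g\<in>F. \<forall>g'\<in>F. g \<noteq> g' \<longrightarrow> (\<lambda>h. h + g) ` V \<inter> (\<lambda>h. h + g') ` V = {})"
proof (induction N)
  case 0
  show ?case by (intro exI[of _ "{}"]) simp
next
  case (Suc N)
  then obtain F where F: "finite F" "card F = N"
    "\<forall>g\<in>F. \<forall>g'\<in>F. g \<noteq> g' \<longrightarrow> (\<lambda>h. h + g) ` V \<inter> (\<lambda>h. h + g') ` V = {}"
    by (elim exE conjE)
  \<comment> \<open>\<open>a + x = b + g\<close> means \<open>x = - a + b + g\<close>. The set
    \<open>F\<close> is added to force \<open>x \<notin> F\<close>, which disjointness does not give
    when \<open>V\<close> is empty.\<close>
  define C where "C = (\<Union>g\<in>insert 0 F. (\<lambda>(a, b). - a + b + g) ` (V \<times> V)) \<union> F"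
  have "continuous_on (V \<times> V) (\<lambda>(a, b). - a + b + g)" for g :: 'g
  proof -
    have "((\<lambda>p. - fst p + snd p + g) \<longlongrightarrow> - fst q + snd q + g) (at q within V \<times> V)" for q
      by (intro tendsto_add tendsto_minus tendsto_fst tendsto_snd tendsto_ident_at tendsto_const)
    then show ?thesis by (simp add: continuous_on_def split_beta')
  qed
  then have "compact ((\<lambda>(a, b). - a + b + g) ` (V \<times> V))" for g :: 'g
    using V by (intro compact_continuous_image compact_Times)
  then have "compact (\<Union>g\<in>insert 0 F. (\<lambda>(a, b). - a + b + g) ` (V \<times> V))"
    using F(1) by (intro compact_UN) simp_all
  then have "compact C" unfolding C_def using finite_imp_compact[OF F(1)] by (rule compact_Un)
  then have "C \<noteq> UNIV" using nc by auto
  then obtain x where x: "x \<notin> C" by blast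
  have disj: "(\<lambda>h. h + x) ` V \<inter> (\<lambda>h. h + g) ` V = {}" if g: "g \<in> F" for g
  proof (rule ccontr)
    assume "(\<lambda>h. h + x) ` V \<inter> (\<lambda>h. h + g) ` V \<noteq> {}"
    then obtain a b where ab: "a \<in> V" "b \<in> V" "a + x = b + g" by blast
    then have "- a + (a + x) = - a + (b + g)" by simp
    then have "x = - a + b + g" by (simp add: add.assoc[symmetric])
    then have "x \<in> (\<lambda>(a, b). - a + b + g) ` (V \<times> V)" using ab by force
    then show False using x g unfolding C_def by blast
  qed
  have "x \<notin> F" using x unfolding C_def by blast
  then have "finite (insert x F)" "card (insert x F) = Suc N" using F by simp_all
  moreover have "\<forall>g\<in>insert x F. \<forall>g'\<in>insert x F. g \<noteq> g' \<longrightarrow>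
      (\<lambda>h. h + g) ` V \<inter> (\<lambda>h. h + g') ` V = {}"
    using F(3) disj by (simp add: Int_commute)
  ultimately show ?case by (intro exI[of _ "insert x F"]) simp
qed

text \<open>Left translates \<open>c + V\<close> keep the left differences of \<open>V\<close>,
  since \<open>- (c + v) + (c + w) = - v + w\<close>. Making them disjoint turns compact sets into
  intersections of a compact and an open set, which are still \<sigma>-compact.\<close>

lemma sigma_compact_small_partition:
  fixes U :: "'g::{topological_group_add, second_countable_topology, t2_space} set"
  assumes lc: "locally_compact_space (euclidean :: 'g topology)"
    and U: "open U" "0 \<in> U" and L: "compact L"
  shows "\<exists>(n::nat) Q. (\<forall>i<n. sigma_compactin euclidean (Q i)) \<and>
    (\<forall>i<n. \<forall>a\<in>Q i. \<forall>b\<in>Q i. - a + b \<in> U) \<and>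
    (\<forall>i<n. \<forall>j<n. i \<noteq> j \<longrightarrow> Q i \<inter> Q j = {}) \<and> L \<subseteq> (\<Union>i<n. Q i)"
proof -
  obtain E where E: "open E" "0 \<in> E" "\<forall>a\<in>E. \<forall>b\<in>E. - a + b \<in> U \<and> a - b \<in> U"
    using small_difference_neighbourhood[OF U] by (elim exE conjE)
  obtain W V where V: "open W" "0 \<in> W" "W \<subseteq> V" "compact V" "V \<subseteq> E"
    using compact_neighbourhood[OF lc E(1,2)] by blast
  have "L \<subseteq> (\<Union>c\<in>UNIV. (\<lambda>h. c + h) ` W)"
  proof
    fix x show "x \<in> (\<Union>c\<in>UNIV. (\<lambda>h. c + h) ` W)"
      using imageI[OF V(2), of "\<lambda>h. x + h"] by auto
  qed
  then have "\<exists>C. finite C \<and> L \<subseteq> (\<Union>c\<in>C. (\<lambda>h. c + h) ` W)"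
    by (rule compactE_image[OF L open_translate(1)[OF V(1)]]) blast
  then obtain C where C: "finite C" "L \<subseteq> (\<Union>c\<in>C. (\<lambda>h. c + h) ` W)" by blast
  obtain n and c :: "nat \<Rightarrow> 'g" where c: "C = c ` {..<n}"
    using finite_imp_nat_seg_image_inj_on[OF C(1)] by (auto simp: lessThan_def)
  define A where "A i = (\<lambda>h. c i + h) ` V" for i
  define Q where "Q = disjointed A"
  have Q: "Q i = A i \<inter> - (\<Union>j<i. A j)" for i
    by (simp add: Q_def disjointed_def atLeast0LessThan Diff_eq)
  have cA: "compact (A i)" for i unfolding A_def by (rule compact_translate(1)[OF V(4)])
  have "sigma_compactin euclidean (Q i)" for i
  proof -
    have "closed (\<Union>j<i. A j)" by (intro closed_UN finite_lessThan ballI compact_imp_closed cA)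
    from sigma_compactin_open[OF lc open_Compl[OF this]]
    have "sigma_compactin euclidean (- (\<Union>j<i. A j))" .
    moreover have "sigma_compactin euclidean (A i)"
      using cA[of i] by (intro compactin_imp_sigma_compactin) simp
    ultimately have "sigma_compactin euclidean (A i \<inter> - (\<Union>j<i. A j))"
      by (rule sigma_compactin_Int[OF Hausdorff_space_euclidean_t2, rotated])
    then show ?thesis by (simp add: Q)
  qed
  moreover have "- a + b \<in> U" if a: "a \<in> Q i" and b: "b \<in> Q i" for a b i
  proof -
    obtain v w where "a = c i + v" "b = c i + w" "v \<in> V" "w \<in> V"
      using a b unfolding Q A_def by blast
    moreover have "- (c i + v) + (c i + w) = - v + w" 
      by (simp only: minus_add add.assoc minus_add_cancel)
    ultimately show ?thesis using E(3) V(5) by auto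
  qed
  moreover have "Q i \<inter> Q j = {}" if "i \<noteq> j" for i j
    using disjoint_family_disjointed[of A] that unfolding Q_def disjoint_family_on_def by simp
  moreover have "(\<Union>i<n. Q i) = (\<Union>i<n. A i)"
    using finite_UN_disjointed_eq[of A n] by (simp add: Q_def atLeast0LessThan)
  moreover have "(\<Union>c\<in>C. (\<lambda>h. c + h) ` W) \<subseteq> (\<Union>i<n. A i)"
    using image_mono[OF V(3)] unfolding c A_def by fast
  with C(2) have "L \<subseteq> (\<Union>i<n. A i)" by (rule order_trans)
  ultimately show ?thesis by (intro exI[of _ n] exI[of _ Q]) auto
qed

subsection \<open>Transverse measures\<close>

lemma action_measurable:
  fixes act :: "'g::{topological_group_add, second_countable_topology, t2_space} \<Rightarrow> 'x \<Rightarrow> 'x"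
  assumes "continuous_action act X" and "second_countable X"
  shows "(\<lambda>(g, x). act g x) \<in> borel \<Otimes>\<^sub>M borel_of X \<rightarrow>\<^sub>M borel_of X"
proof -
  have "sets (borel_of (euclidean :: 'g topology) \<Otimes>\<^sub>M borel_of X) = sets (borel \<Otimes>\<^sub>M borel_of X)"
    by (intro sets_pair_measure_cong) simp_all
  then show ?thesis
    using continuous_map_prod_measurable[OF second_countable_euclidean assms(2), of X "\<lambda>(g, x). act g x"]
      assms(1)
    unfolding continuous_action_def by (simp cong: measurable_cong_sets)
qed

lemma action_zero:
  assumes "continuous_action act X" and "x \<in> topspace X"
  shows "act 0 x = x"
  using assms by (simp add: continuous_action_def)

lemma action_add:
  assumes "continuous_action act X" and "x \<in> topspace X"
  shows "act (g + h) x = act g (act h x)"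
  using assms by (simp add: continuous_action_def)

lemma action_diff:
  assumes "continuous_action act X" and "x \<in> topspace X"
  shows "act (g - h) (act h x) = act g x"
  using action_add[OF assms, of "g - h" h] by simp

lemma action_uminus:
  assumes "continuous_action act X" and "x \<in> topspace X"
  shows "act (- g) (act g x) = x" "act g (act (- g) x) = x"
  using assms by (simp_all add: continuous_action_def) (metis left_minus right_minus)+

lemma action_topspace:
  assumes "continuous_action act X" and "x \<in> topspace X"
  shows "act g x \<in> topspace X"
proof -
  have "continuous_map (prod_topology euclidean X) X (\<lambda>(g, x). act g x)"
    using assms(1) by (simp add: continuous_action_def)
  from funcset_mem[OF continuous_map_funspace[OF this], of "(g, x)"] show ?thesis
    using assms(2) by simp
qed

lemma transverse_action_measurable:
  fixes m :: "'g::{topological_group_add, second_countable_topology, t2_space} measure"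
  assumes m: "sets m = sets borel"
    and X: "second_countable X" and act: "continuous_action act X"
    and \<mu>: "sets \<mu> = sets (borel_of X)"
    and \<nu>: "transverse_measure m act \<mu> T \<nu>"
  shows "(\<lambda>(g, x). act g x) \<in> m \<Otimes>\<^sub>M \<nu> \<rightarrow>\<^sub>M \<mu>"
proof -
  have \<nu>s: "sets \<nu> = sets (restrict_space \<mu> T)"
    using \<nu> unfolding transverse_measure_def by (rule conjunct1)
  have 1: "fst \<in> m \<Otimes>\<^sub>M \<nu> \<rightarrow>\<^sub>M borel"
    using measurable_fst[of m \<nu>] by (simp add: measurable_cong_sets[OF refl m])
  have "(\<lambda>x. x) \<in> \<nu> \<rightarrow>\<^sub>M borel_of X"
    using measurable_restrict_space1[OF measurable_ident, of "borel_of X" T]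
    by (simp add: measurable_cong_sets[OF \<nu>s refl] id_def
        measurable_cong_sets[OF sets_restrict_space_cong[OF \<mu>] refl])
  then have 2: "snd \<in> m \<Otimes>\<^sub>M \<nu> \<rightarrow>\<^sub>M borel_of X"
    by (rule measurable_compose[OF measurable_snd])
  show ?thesis
    using measurable_compose[OF measurable_Pair[OF 1 2] action_measurable[OF act X]]
    by (simp add: measurable_cong_sets[OF refl \<mu>] split_beta')
qed

text \<open>
  If \<open>- Q + Q\<close> lies in a separating neighbourhood, then \<open>(h, t) \<mapsto> h.t\<close> is injective on \<open>Q \<times> T\<close>, so the
  sum in the transverse formula has at most one nonzero term. The integral of that sum is a lower
  integral (the sum need not be measurable), which is enough for an upper bound.
\<close>

lemma transverse_measure_le:
  fixes m :: "'g::{topological_group_add, second_countable_topology, t2_space} measure"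
  assumes m: "sets m = sets borel"
    and X: "second_countable X" and act: "continuous_action act X"
    and \<mu>: "sets \<mu> = sets (borel_of X)"
    and T: "T \<in> sets \<mu>"
    and sep: "{h. act h ` T \<inter> T \<noteq> {}} \<inter> U \<subseteq> {0}"
    and \<nu>: "transverse_measure m act \<mu> T \<nu>"
    and Q: "Q \<in> sets borel" "\<And>a b. a \<in> Q \<Longrightarrow> b \<in> Q \<Longrightarrow> - a + b \<in> U"
    and A: "A \<in> sets \<mu>"
  shows "(\<integral>\<^sup>+ h. (\<integral>\<^sup>+ t. indicator Q h * indicator A (act h t) \<partial>\<nu>) \<partial>m) \<le> emeasure \<mu> A"
proof -
  \<comment> \<open>In the formula \<open>f\<close> is evaluated at \<open>(- h, h.s)\<close>. As
    \<open>- h\<close> moves \<open>h.s\<close> back to \<open>s\<close>, the value is the indicator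
    of \<open>Q\<close> at \<open>- h\<close> times that of \<open>A\<close> at
    \<open>s\<close>.\<close>
  define f :: "'g \<times> 'a \<Rightarrow> real" where "f = (\<lambda>(h, t). indicator Q h * indicator A (act h t))"
  have a: "(\<lambda>(g, x). act g x) \<in> m \<Otimes>\<^sub>M \<nu> \<rightarrow>\<^sub>M \<mu>"
    by (rule transverse_action_measurable[OF m X act \<mu> \<nu>])
  have "(\<lambda>p. indicator Q (fst p) * indicator A ((\<lambda>(g, x). act g x) p) :: real)
      \<in> borel_measurable (m \<Otimes>\<^sub>M \<nu>)"
    using Q(1) A m
    by (intro borel_measurable_times measurable_compose[OF a] measurable_compose[OF measurable_fst]
        borel_measurable_indicator) simp_all
  then have f: "f \<in> borel_measurable (m \<Otimes>\<^sub>M \<nu>)" by (simp add: f_def split_beta')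
  have bd: "\<exists>C. \<forall>h. \<forall>t\<in>T. 0 \<le> f (h, t) \<and> f (h, t) \<le> C"
    by (rule exI[of _ 1]) (simp add: f_def indicator_def)
  have "(\<integral>\<^sup>+ h. (\<integral>\<^sup>+ t. indicator Q h * indicator A (act h t) \<partial>\<nu>) \<partial>m)
      = (\<integral>\<^sup>+ h. (\<integral>\<^sup>+ t. ennreal (f (h, t)) \<partial>\<nu>) \<partial>m)"
    by (intro nn_integral_cong) (simp add: f_def indicator_def)
  also have "\<dots> = (\<integral>\<^sup>+ s. (\<Sum>\<^sub>\<infinity>h\<in>return_set act T s. ennreal (f (- h, act h s))) \<partial>\<mu>)"
    using \<nu>[unfolded transverse_measure_def, THEN conjunct2, rule_format, OF conjI[OF f bd]] by simp
  also have "\<dots> \<le> (\<integral>\<^sup>+ s. indicator A s \<partial>\<mu>)"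
  proof (rule nn_integral_mono)
    fix s assume "s \<in> space \<mu>"
    then have s: "s \<in> topspace X" using sets_eq_imp_space_eq[OF \<mu>] by simp
    \<comment> \<open>\<open>h' - h\<close> moves one point of \<open>T\<close> to another, and it
      equals \<open>- a + b\<close> for \<open>a = - h'\<close> and \<open>b = - h\<close>, both in
      \<open>Q\<close>.\<close>
    have uniq: "h = h'" if h: "h \<in> return_set act T s" "h' \<in> return_set act T s" "- h \<in> Q" "- h' \<in> Q"
      for h h'
    proof -
      have "act (h' - h) (act h s) = act h' s" by (rule action_diff[OF act s])
      then have "act (h' - h) ` T \<inter> T \<noteq> {}" using h(1,2) by (auto simp: return_set_def)
      moreover have "h' - h \<in> U" using Q(2)[OF h(4,3)] by simp
      ultimately have "h' - h = 0" using sep by blast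
      then show "h = h'" by simp
    qed
    have f_eq: "f (- h, act h s) = indicator Q (- h) * indicator A s" for h
      using action_uminus[OF act s, of h] by (simp add: f_def)
    show "(\<Sum>\<^sub>\<infinity>h\<in>return_set act T s. ennreal (f (- h, act h s))) \<le> indicator A s"
    proof (cases "\<exists>h\<in>return_set act T s. - h \<in> Q")
      case False
      then have "(\<Sum>\<^sub>\<infinity>h\<in>return_set act T s. ennreal (f (- h, act h s))) = 0"
        by (intro infsum_0) (simp add: f_eq)
      then show ?thesis by simp
    next
      case True
      then obtain h where h: "h \<in> return_set act T s" "- h \<in> Q" by blast
      then have "(\<Sum>\<^sub>\<infinity>h\<in>return_set act T s. ennreal (f (- h, act h s)))
          = (\<Sum>\<^sub>\<infinity>h\<in>{h}. ennreal (f (- h, act h s)))"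
        using uniq by (intro infsum_cong_neutral) (auto simp: f_eq indicator_def)
      also have "\<dots> = indicator A s" using h(2) by (simp add: f_eq indicator_def)
      finally show ?thesis by simp
    qed
  qed
  also have "\<dots> = emeasure \<mu> A" using A by simp
  finally show ?thesis .
qed

text \<open>Taking the whole space for \<open>A\<close> in \<open>transverse_measure_le\<close>
  bounds \<open>m(V)\<close> times the mass of \<open>\<nu>\<close> by the mass of
  \<open>\<mu>\<close>, and \<open>m(V)\<close> is positive.\<close>

lemma finite_transverse_measure:
  fixes m :: "'g::{topological_group_add, second_countable_topology, t2_space} measure"
  assumes m: "left_haar_measure m"
    and X: "second_countable X" and act: "continuous_action act X"
    and \<mu>: "sets \<mu> = sets (borel_of X)" "finite_measure \<mu>"
    and T: "T \<in> sets \<mu>"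
    and U: "open U" "0 \<in> U" and sep: "{h. act h ` T \<inter> T \<noteq> {}} \<inter> U \<subseteq> {0}"
    and \<nu>: "transverse_measure m act \<mu> T \<nu>"
  shows "finite_measure \<nu>"
proof -
  have ms: "sets m = sets borel" using m unfolding left_haar_measure_def by (rule conjunct1)
  have \<nu>s: "sets \<nu> = sets (restrict_space \<mu> T)"
    using \<nu> unfolding transverse_measure_def by (rule conjunct1)
  have TX: "T \<subseteq> topspace X" using sets.sets_into_space[OF T] sets_eq_imp_space_eq[OF \<mu>(1)] by simp
  have sp: "space \<nu> = T"
    using sets_eq_imp_space_eq[OF \<nu>s] sets.sets_into_space[OF T] by (simp add: space_restrict_space Int_absorb2)
  obtain V where V: "open V" "0 \<in> V" "\<forall>a\<in>V. \<forall>b\<in>V. - a + b \<in> U \<and> a - b \<in> U"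
    using small_difference_neighbourhood[OF U] by (elim exE conjE)
  have "emeasure m V * emeasure \<nu> (space \<nu>) = (\<integral>\<^sup>+ h. emeasure \<nu> (space \<nu>) * indicator V h \<partial>m)"
    using V(1) ms by (subst nn_integral_cmult_indicator) (simp_all add: mult.commute)
  also have "\<dots> = (\<integral>\<^sup>+ h. (\<integral>\<^sup>+ t. indicator V h * indicator (space \<mu>) (act h t) \<partial>\<nu>) \<partial>m)"
  proof (intro nn_integral_cong)
    fix h
    have "(\<integral>\<^sup>+ t. indicator V h * indicator (space \<mu>) (act h t) \<partial>\<nu>) = (\<integral>\<^sup>+ t. indicator V h \<partial>\<nu>)"
      using TX sp sets_eq_imp_space_eq[OF \<mu>(1)] action_topspace[OF act]
      by (intro nn_integral_cong) (auto simp: indicator_def)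
    then show "emeasure \<nu> (space \<nu>) * indicator V h
        = (\<integral>\<^sup>+ t. indicator V h * indicator (space \<mu>) (act h t) \<partial>\<nu>)"
      by (simp add: mult.commute)
  qed
  also have "\<dots> \<le> emeasure \<mu> (space \<mu>)"
    using V(1,3) by (intro transverse_measure_le[OF ms X act \<mu>(1) T sep \<nu>]) auto
  also have "\<dots> < \<infinity>" using finite_measure.emeasure_finite[OF \<mu>(2)] by (simp add: less_top)
  finally have "emeasure m V * emeasure \<nu> (space \<nu>) < \<infinity>" .
  then show ?thesis
    using left_haar_measure_open_pos[OF m V(1,2)]
    by (intro finite_measureI) (auto simp: ennreal_mult_less_top)
qed

text \<open>The iterated integral in \<open>transverse_measure_le\<close> is, by Fubini, the product
  measure of the preimage of \<open>A\<close>.\<close>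

lemma distr_action_transverse_le:
  fixes m :: "'g::{topological_group_add, second_countable_topology, t2_space} measure"
  assumes m: "sets m = sets borel"
    and X: "second_countable X" and act: "continuous_action act X"
    and \<mu>: "sets \<mu> = sets (borel_of X)"
    and T: "T \<in> sets \<mu>"
    and sep: "{h. act h ` T \<inter> T \<noteq> {}} \<inter> U \<subseteq> {0}"
    and \<nu>: "transverse_measure m act \<mu> T \<nu>" "finite_measure \<nu>"
    and Q: "Q \<in> sets borel" "\<And>a b. a \<in> Q \<Longrightarrow> b \<in> Q \<Longrightarrow> - a + b \<in> U"
  shows "(\<lambda>(g, x). act g x) \<in> restrict_space m Q \<Otimes>\<^sub>M \<nu> \<rightarrow>\<^sub>M \<mu>"
    and "distr (restrict_space m Q \<Otimes>\<^sub>M \<nu>) \<mu> (\<lambda>(g, x). act g x) \<le> \<mu>"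
proof -
  interpret sigma_finite_measure \<nu> using \<nu>(2) by (rule finite_measure.axioms(1))
  have "(\<lambda>p. (fst p, snd p)) \<in> restrict_space m Q \<Otimes>\<^sub>M \<nu> \<rightarrow>\<^sub>M m \<Otimes>\<^sub>M \<nu>"
  proof (rule measurable_Pair[OF _ measurable_snd])
    have "(\<lambda>x. x) \<in> restrict_space m Q \<rightarrow>\<^sub>M m"
      using measurable_restrict_space1[OF measurable_ident, of m Q] by (simp add: id_def)
    then show "fst \<in> restrict_space m Q \<Otimes>\<^sub>M \<nu> \<rightarrow>\<^sub>M m" by (rule measurable_compose[OF measurable_fst])
  qed
  from measurable_compose[OF this transverse_action_measurable[OF m X act \<mu> \<nu>(1)]]
  show a: "(\<lambda>(g, x). act g x) \<in> restrict_space m Q \<Otimes>\<^sub>M \<nu> \<rightarrow>\<^sub>M \<mu>" by simp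
  show "distr (restrict_space m Q \<Otimes>\<^sub>M \<nu>) \<mu> (\<lambda>(g, x). act g x) \<le> \<mu>"
    unfolding le_measure[OF sets_distr]
  proof
    fix A assume "A \<in> sets (distr (restrict_space m Q \<Otimes>\<^sub>M \<nu>) \<mu> (\<lambda>(g, x). act g x))"
    then have A: "A \<in> sets \<mu>" by simp
    let ?D = "(\<lambda>(g, x). act g x) -` A \<inter> space (restrict_space m Q \<Otimes>\<^sub>M \<nu>)"
    have "emeasure (distr (restrict_space m Q \<Otimes>\<^sub>M \<nu>) \<mu> (\<lambda>(g, x). act g x)) A
        = emeasure (restrict_space m Q \<Otimes>\<^sub>M \<nu>) ?D"
      by (rule emeasure_distr[OF a A])
    also have "\<dots> = (\<integral>\<^sup>+ h. (\<integral>\<^sup>+ t. indicator ?D (h, t) \<partial>\<nu>) \<partial>restrict_space m Q)"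
      by (rule emeasure_pair_measure[OF measurable_sets[OF a A]])
    also have "\<dots> = (\<integral>\<^sup>+ h. (\<integral>\<^sup>+ t. indicator A (act h t) \<partial>\<nu>) \<partial>restrict_space m Q)"
      by (intro nn_integral_cong) (simp add: space_pair_measure indicator_def)
    also have "\<dots> = (\<integral>\<^sup>+ h. (\<integral>\<^sup>+ t. indicator A (act h t) \<partial>\<nu>) * indicator Q h \<partial>m)"
      using Q(1) m by (intro nn_integral_restrict_space) simp
    also have "\<dots> = (\<integral>\<^sup>+ h. (\<integral>\<^sup>+ t. indicator Q h * indicator A (act h t) \<partial>\<nu>) \<partial>m)"
      by (intro nn_integral_cong) (simp add: indicator_def)
    also have "\<dots> \<le> emeasure \<mu> A" by (rule transverse_measure_le[OF m X act \<mu> T sep \<nu>(1) Q A])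
    finally show "emeasure (distr (restrict_space m Q \<Otimes>\<^sub>M \<nu>) \<mu> (\<lambda>(g, x). act g x)) A \<le> emeasure \<mu> A" .
  qed
qed

text \<open>Cover \<open>K\<close> by finitely many right translates \<open>V + c\<close>. Two
  return times in the same translate differ by a right difference in \<open>U\<close> that moves a
  point of \<open>T\<close> into \<open>T\<close>, so they coincide. The number of translates bounds
  the returns for every \<open>s\<close>.\<close>

lemma card_returns_bounded:
  fixes act :: "'g::{topological_group_add, second_countable_topology, t2_space} \<Rightarrow> 'x \<Rightarrow> 'x"
  assumes act: "continuous_action act X"
    and U: "open U" "0 \<in> U" and sep: "{h. act h ` T \<inter> T \<noteq> {}} \<inter> U \<subseteq> {0}"
    and K: "compact K"
  shows "\<exists>M. \<forall>s\<in>topspace X. finite {g\<in>K. act g s \<in> T} \<and> card {g\<in>K. act g s \<in> T} \<le> M"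
proof -
  obtain V where V: "open V" "0 \<in> V" "\<forall>a\<in>V. \<forall>b\<in>V. - a + b \<in> U \<and> a - b \<in> U"
    using small_difference_neighbourhood[OF U] by (elim exE conjE)
  have "K \<subseteq> (\<Union>c\<in>UNIV. (\<lambda>h. h + c) ` V)"
  proof
    fix x show "x \<in> (\<Union>c\<in>UNIV. (\<lambda>h. h + c) ` V)"
      using imageI[OF V(2), of "\<lambda>h. h + x"] by auto
  qed
  then have "\<exists>C. finite C \<and> K \<subseteq> (\<Union>c\<in>C. (\<lambda>h. h + c) ` V)"
    by (rule compactE_image[OF K open_translate(2)[OF V(1)]]) blast
  then obtain C where C: "finite C" "K \<subseteq> (\<Union>c\<in>C. (\<lambda>h. h + c) ` V)" by blast
  have "finite {g\<in>K. act g s \<in> T} \<and> card {g\<in>K. act g s \<in> T} \<le> card C" if s: "s \<in> topspace X" for s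
  proof -
    have "\<forall>g\<in>{g\<in>K. act g s \<in> T}. \<exists>c. c \<in> C \<and> g - c \<in> V"
    proof
      fix g assume "g \<in> {g\<in>K. act g s \<in> T}"
      then obtain c v where "c \<in> C" "v \<in> V" "g = v + c" using C(2) by blast
      then show "\<exists>c. c \<in> C \<and> g - c \<in> V" by (intro exI[of _ c]) simp
    qed
    then obtain c where c: "\<forall>g\<in>{g\<in>K. act g s \<in> T}. c g \<in> C \<and> g - c g \<in> V" by (rule bchoice[THEN exE])
    have "inj_on c {g\<in>K. act g s \<in> T}"
    proof (rule inj_onI)
      fix g h assume gh: "g \<in> {g\<in>K. act g s \<in> T}" "h \<in> {g\<in>K. act g s \<in> T}" "c g = c h"
      have "(g - c g) - (h - c g) \<in> U" using c gh V(3) by metis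
      moreover have "(g - c h) - (h - c h) = g - h"
        by (simp only: diff_conv_add_uminus minus_add minus_minus add.assoc minus_add_cancel)
      ultimately have "g - h \<in> U" using gh(3) by simp
      moreover have "act (g - h) (act h s) \<in> act (g - h) ` T \<inter> T"
        using gh(1,2) action_diff[OF act s] by (intro IntI imageI) simp_all
      then have "act (g - h) ` T \<inter> T \<noteq> {}" by blast
      ultimately have "g - h = 0" using sep by blast
      then show "g = h" by simp
    qed
    moreover have "c ` {g\<in>K. act g s \<in> T} \<subseteq> C" using c by blast
    ultimately show ?thesis using C(1) by (meson card_inj_on_le inj_on_finite)
  qed
  then show ?thesis by blast
qed

subsection \<open>Wandering sets are null\<close>

locale commensurable_sections =
  fixes m :: "'g::{topological_group_add, second_countable_topology, t2_space} measure"
    and X :: "'i::finite \<Rightarrow> 'x topology"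
    and act :: "'i \<Rightarrow> 'g \<Rightarrow> 'x \<Rightarrow> 'x"
    and Z :: "'i \<Rightarrow> 'x set"
    and \<mu> \<nu> :: "'i \<Rightarrow> 'x measure"
  assumes lc: "locally_compact_space (euclidean :: 'g topology)"
    and noncompact: "\<not> compact (UNIV :: 'g set)"
    and unimod: "unimodular TYPE('g)"
    and haar: "left_haar_measure m"
    and polish: "\<And>k. polish_topology (X k)"
    and act: "\<And>k. continuous_action (act k) (X k)"
    and Z: "\<And>k. separated_cross_section UNIV (act k) (borel_of (X k)) (Z k)"
    and \<mu>: "\<And>k. sets (\<mu> k) = sets (borel_of (X k))" "\<And>k. prob_space (\<mu> k)"
    and \<nu>: "\<And>k. transverse_measure m (act k) (\<mu> k) (Z k) (\<nu> k)"
    and comm: "commensurable X act Z"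
begin

section \<open>Standing facts about the factors and their product\<close>

abbreviation Y where "Y \<equiv> product_topology X UNIV"

abbreviation diag_act :: "'g \<Rightarrow> ('i \<Rightarrow> 'x) \<Rightarrow> 'i \<Rightarrow> 'x" where
  "diag_act g \<equiv> product_action act (\<lambda>_. g)"

lemma sc: "second_countable (X k)"
  using polish[of k] unfolding polish_topology_def by (rule conjunct2)

lemma sets_m: "sets m = sets borel"
  using haar unfolding left_haar_measure_def by (rule conjunct1)

lemma polish_Y: "polish_topology Y"
  unfolding polish_topology_def
proof
  have "\<forall>i\<in>UNIV. completely_metrizable_space (X i)" using polish by (simp add: polish_topology_def)
  moreover have "countable {i \<in> UNIV. \<not> (\<exists>a. topspace (X i) \<subseteq> {a})}" by (rule countable_finite) simp
  ultimately show "completely_metrizable_space Y"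
    unfolding completely_metrizable_space_product_topology by blast
  show "second_countable Y" by (intro second_countable_product_topology sc) simp
qed

lemma metrizable_Y: "metrizable_space Y"
  using polish_Y unfolding polish_topology_def
  by (intro completely_metrizable_imp_metrizable_space) (rule conjunct1)

lemma Hausdorff_Y: "Hausdorff_space Y"
  by (rule metrizable_imp_Hausdorff_space[OF metrizable_Y])

lemma topspace_Y: "x \<in> topspace Y \<longleftrightarrow> (\<forall>k. x k \<in> topspace (X k))"
  by (simp add: PiE_iff)

lemma Z_sets: "Z k \<in> sets (\<mu> k)"
  using Z[of k] unfolding separated_cross_section_def cross_section_def \<mu>(1) by blast

lemma Z_subset: "Z k \<subseteq> topspace (X k)"
  using sets.sets_into_space[OF Z_sets[of k]] sets_eq_imp_space_eq[OF \<mu>(1)[of k]] by simp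

text \<open>Finitely many neighbourhoods are intersected, so that one partition of the group into
  small pieces serves all coordinates.\<close>

lemma uniform_separation:
  "\<exists>U. open U \<and> 0 \<in> U \<and> (\<forall>k. {h. act k h ` Z k \<inter> Z k \<noteq> {}} \<inter> U \<subseteq> {0})"
proof -
  have "\<exists>U. open U \<and> 0 \<in> U \<and> {h. act k h ` Z k \<inter> Z k \<noteq> {}} \<inter> U \<subseteq> {0}" for k
    using Z[of k] unfolding separated_cross_section_def by (auto simp: openin_subtopology)
  then obtain U where U: "\<And>k. open (U k)" "\<And>k. 0 \<in> U k"
    "\<And>k. {h. act k h ` Z k \<inter> Z k \<noteq> {}} \<inter> U k \<subseteq> {0}" by metis
  show ?thesis
  proof (intro exI[of _ "\<Inter>k. U k"] conjI allI)
    show "open (\<Inter>k. U k)" by (intro open_INT) (simp_all add: U(1))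
    show "0 \<in> (\<Inter>k. U k)" using U(2) by simp
    show "{h. act k h ` Z k \<inter> Z k \<noteq> {}} \<inter> (\<Inter>k. U k) \<subseteq> {0}" for k
      using U(3)[of k] by (rule order_trans[rotated]) (intro Int_mono INT_lower order_refl UNIV_I)
  qed
qed

lemma finite_\<nu>: "finite_measure (\<nu> k)"
proof -
  obtain U where U: "open U" "0 \<in> U" "\<forall>k. {h. act k h ` Z k \<inter> Z k \<noteq> {}} \<inter> U \<subseteq> {0}"
    using uniform_separation by (elim exE conjE)
  have "finite_measure (\<mu> k)" using \<mu>(2) by (rule prob_space.finite_measure)
  from finite_transverse_measure[OF haar sc act \<mu>(1) this Z_sets U(1,2) U(3)[rule_format] \<nu>]
  show ?thesis .
qed

lemma sets_\<nu>: "sets (\<nu> k) = sets (restrict_space (\<mu> k) (Z k))"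
  using \<nu>[of k] unfolding transverse_measure_def by (rule conjunct1)

lemma space_\<nu>: "space (\<nu> k) = Z k"
  using sets_eq_imp_space_eq[OF sets_\<nu>[of k]] sets.sets_into_space[OF Z_sets[of k]]
  by (simp add: space_restrict_space Int_absorb2)

lemma sets_borel_of_Y_PiM_\<mu>: "A \<in> sets (borel_of Y) \<Longrightarrow> A \<in> sets (PiM UNIV \<mu>)"
proof -
  have "sets (PiM UNIV \<mu>) = sets (PiM UNIV (\<lambda>k. borel_of (X k)))"
    by (rule sets_PiM_cong[OF refl \<mu>(1)])
  then show "A \<in> sets (borel_of Y) \<Longrightarrow> A \<in> sets (PiM UNIV \<mu>)"
    using sets_borel_of_product_topology[of UNIV X, OF finite_class.finite_UNIV sc] by blast
qed

lemma id_measurable_\<nu>: "(\<lambda>z. z) \<in> PiM UNIV \<nu> \<rightarrow>\<^sub>M borel_of Y"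
proof -
  have "(\<lambda>x. x) \<in> \<nu> k \<rightarrow>\<^sub>M borel_of (X k)" for k
    using measurable_restrict_space1[OF measurable_ident, of "borel_of (X k)" "Z k"]
    by (simp add: measurable_cong_sets[OF sets_\<nu> refl] id_def
        measurable_cong_sets[OF sets_restrict_space_cong[OF \<mu>(1)] refl])
  then have id: "(\<lambda>z. z) \<in> PiM UNIV \<nu> \<rightarrow>\<^sub>M PiM UNIV (\<lambda>k. borel_of (X k))"
    using measurable_PiM_map[of UNIV "\<lambda>k x. x" \<nu> "\<lambda>k. borel_of (X k)"] by (simp add: restrict_UNIV)
  show ?thesis
  proof (rule measurable_borel_ofI)
    show "(\<lambda>z. z) \<in> space (PiM UNIV \<nu>) \<rightarrow> topspace Y"
      using measurable_space[OF id] by (simp add: space_PiM)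
    show "(\<lambda>z. z) -` U \<inter> space (PiM UNIV \<nu>) \<in> sets (PiM UNIV \<nu>)" if "openin Y U" for U
      by (rule measurable_sets[OF id], rule openin_product_topology_sets_PiM[OF _ sc that]) simp
  qed
qed

section \<open>Product action and diagonal action\<close>

lemma continuous_map_act:
  assumes "continuous_map W euclidean g" "continuous_map W (X k) f"
  shows "continuous_map W (X k) (\<lambda>w. act k (g w) (f w))"
proof -
  have "continuous_map (prod_topology euclidean (X k)) (X k) (\<lambda>(g, x). act k g x)"
    using act[of k] by (simp add: continuous_action_def)
  from continuous_map_compose[OF continuous_map_pairedI[OF assms] this]
  have "continuous_map W (X k) ((\<lambda>(g, x). act k g x) \<circ> (\<lambda>w. (g w, f w)))" .
  then show ?thesis by (simp add: comp_def)
qed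

lemma continuous_map_product_action:
  "continuous_map (prod_topology (product_topology (\<lambda>_::'i. euclidean) UNIV) Y) Y
    (\<lambda>p. product_action act (fst p) (snd p))"
  unfolding continuous_map_componentwise_UNIV product_action_def
proof
  fix k
  have "continuous_map (prod_topology (product_topology (\<lambda>_::'i. euclidean) UNIV) Y) euclidean
      ((\<lambda>h. h k) \<circ> fst)"
    by (rule continuous_map_compose[OF continuous_map_fst continuous_map_product_projection]) simp
  moreover have "continuous_map (prod_topology (product_topology (\<lambda>_::'i. euclidean) UNIV) Y) (X k)
      ((\<lambda>x. x k) \<circ> snd)"
    by (rule continuous_map_compose[OF continuous_map_snd continuous_map_product_projection]) simp
  ultimately show "continuous_map (prod_topology (product_topology (\<lambda>_::'i. euclidean) UNIV) Y) (X k)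
      (\<lambda>p. act k (fst p k) (snd p k))"
    unfolding comp_def by (rule continuous_map_act)
qed

lemma continuous_map_diag_act:
  "continuous_map (prod_topology euclidean Y) Y (\<lambda>p. diag_act (fst p) (snd p))"
  unfolding continuous_map_componentwise_UNIV product_action_def
proof
  fix k
  have "continuous_map (prod_topology euclidean Y) (X k) ((\<lambda>x. x k) \<circ> snd)"
    by (rule continuous_map_compose[OF continuous_map_snd continuous_map_product_projection]) simp
  then show "continuous_map (prod_topology euclidean Y) (X k) (\<lambda>p. act k (fst p) (snd p k))"
    unfolding comp_def by (rule continuous_map_act[OF continuous_map_fst])
qed

lemma product_action_topspace: "x \<in> topspace Y \<Longrightarrow> product_action act h x \<in> topspace Y"
  unfolding topspace_Y product_action_def using action_topspace[OF act] by blast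

lemma product_action_add:
  "x \<in> topspace Y \<Longrightarrow> product_action act (\<lambda>k. g k + h k) x = product_action act g (product_action act h x)"
  unfolding topspace_Y product_action_def using action_add[OF act] by (intro ext) blast

lemma product_action_zero: "x \<in> topspace Y \<Longrightarrow> product_action act (\<lambda>_. 0) x = x"
  unfolding topspace_Y product_action_def using action_zero[OF act] by (intro ext) blast

lemma diag_act_uminus: "x \<in> topspace Y \<Longrightarrow> diag_act (- g) (diag_act g x) = x"
  unfolding topspace_Y product_action_def using action_uminus(1)[OF act] by (intro ext) blast

lemma diag_act_diff: "x \<in> topspace Y \<Longrightarrow> diag_act (- g + h) x = diag_act (- g) (diag_act h x)"
  using product_action_add[of x "\<lambda>_. - g" "\<lambda>_. h"] .

text \<open>A relative neighbourhood of 0 in the kernel contains the trace of a box, and the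
  finitely many sides are intersected. One \<open>E\<close> for all coordinates suits the kernel
  elements that occur later, whose coordinates all come from the same \<open>V\<close>.\<close>

lemma kernel_separation:
  "\<exists>E. open E \<and> 0 \<in> E \<and> (\<forall>n x. n k = 0 \<and> (\<forall>j. n j \<in> E) \<and> x \<in> intersection_space X act Z \<and>
      product_action act n x \<in> intersection_space X act Z \<longrightarrow> n = (\<lambda>_. 0))"
proof -
  let ?S = "intersection_space X act Z"
  have "separated_cross_section (coordinate_kernel k) (product_action act) (borel_of Y) ?S"
    using comm unfolding commensurable_def by blast
  then obtain U where U: "openin (top_of_set (coordinate_kernel k)) U" "0 \<in> U"
    "{h \<in> coordinate_kernel k. product_action act h ` ?S \<inter> ?S \<noteq> {}} \<inter> U = {0}"
    unfolding separated_cross_section_def by (elim exE conjE)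
  obtain W where W: "open W" "U = coordinate_kernel k \<inter> W" using U(1) by (auto simp: openin_open)
  then have "openin (product_topology (\<lambda>_::'i. euclidean) UNIV) W" "0 \<in> W"
    using U(2) by (simp_all add: open_fun_def)
  then obtain V where V: "\<And>j. open (V j)" "0 \<in> Pi\<^sub>E UNIV V" "Pi\<^sub>E UNIV V \<subseteq> W"
    unfolding openin_product_topology_alt by (metis UNIV_I open_openin)
  show ?thesis
  proof (intro exI[of _ "\<Inter>j. V j"] conjI allI impI)
    show "open (\<Inter>j. V j)" by (intro open_INT) (simp_all add: V(1))
    show "0 \<in> (\<Inter>j. V j)" using V(2) by (simp add: PiE_iff)
    fix n x assume *: "n k = 0 \<and> (\<forall>j. n j \<in> (\<Inter>j. V j)) \<and> x \<in> ?S \<and> product_action act n x \<in> ?S"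
    then have n: "n k = 0" "\<forall>j. n j \<in> (\<Inter>j. V j)" and x: "x \<in> ?S" "product_action act n x \<in> ?S"
      by blast+
    have "n \<in> Pi\<^sub>E UNIV V" using n(2) by (simp add: PiE_iff)
    then have "n \<in> U" using V(3) W(2) n(1) unfolding coordinate_kernel_def by blast
    moreover have "n \<in> coordinate_kernel k" using n(1) by (simp add: coordinate_kernel_def)
    moreover have "product_action act n ` ?S \<inter> ?S \<noteq> {}" using x by blast
    ultimately have "n \<in> {0}" using U(3) by blast
    then show "n = (\<lambda>_. 0)" by (simp add: zero_fun_def)
  qed
qed

section \<open>Multiplicity and mass of the translated boxes\<close>

lemma mem_intersection_space:
  assumes "z \<in> topspace Y" "diag_act g z \<in> Pi\<^sub>E UNIV Z"
  shows "z \<in> intersection_space X act Z"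
  using assms unfolding intersection_space_def product_action_def by (auto simp: PiE_iff)

text \<open>
  Write \<open>h = n + \<delta>(h k0)\<close> with \<open>n\<close> in the kernel of the coordinate \<open>k0\<close> and \<open>\<delta>\<close> the diagonal
  embedding. Separation of the intersection space for that kernel determines \<open>n\<close> from \<open>x = h.z\<close>,
  and two admissible values of \<open>h k0\<close> differ by a return time in \<open>K\<close>.
\<close>

lemma wandering_multiplicity:
  assumes E: "\<forall>n x. n k0 = 0 \<and> (\<forall>j. n j \<in> E) \<and> x \<in> intersection_space X act Z \<and>
      product_action act n x \<in> intersection_space X act Z \<longrightarrow> n = (\<lambda>_. 0)"
    and V: "\<forall>a\<in>V. \<forall>b\<in>V. \<forall>c\<in>V. \<forall>d\<in>V. - (a - b) + (c - d) \<in> E"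
    and B: "B \<subseteq> Pi\<^sub>E UNIV Z"
    and wander: "\<forall>z\<in>B. \<forall>g. diag_act g z \<in> B \<longrightarrow> g \<in> K"
    and h: "\<forall>j. h j \<in> (\<lambda>v. v + g) ` V" and h': "\<forall>j. h' j \<in> (\<lambda>v. v + g') ` V"
    and z: "z \<in> B" "z' \<in> B"
    and eq: "product_action act h z = product_action act h' z'"
  shows "h j - h k0 = h' j - h' k0"
    and "- h' k0 + h k0 \<in> {q \<in> K. act k0 q (z k0) \<in> Z k0}"
proof -
  have Bt: "z \<in> topspace Y" if "z \<in> B" for z
    using that B Z_subset by (auto simp: topspace_Y PiE_iff)
  note zt = Bt[OF z(1)] and zt' = Bt[OF z(2)]
  let ?y = "diag_act (h k0) z" and ?y' = "diag_act (h' k0) z'"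
  have yt: "?y \<in> topspace Y" and yt': "?y' \<in> topspace Y"
    by (intro product_action_topspace zt zt')+
  \<comment> \<open>Both \<open>?y\<close> and \<open>?y'\<close> lie on diagonal orbits that meet
    the product of the \<open>Z k\<close>, as is seen by going back with \<open>- h k0\<close> and
    \<open>- h' k0\<close>.\<close>
  have yI: "?y \<in> intersection_space X act Z"
    using diag_act_uminus[OF zt, of "h k0"] z(1) B
    by (intro mem_intersection_space[OF yt, of "- h k0"]) auto
  have yI': "?y' \<in> intersection_space X act Z"
    using diag_act_uminus[OF zt', of "h' k0"] z(2) B
    by (intro mem_intersection_space[OF yt', of "- h' k0"]) auto
  let ?n = "\<lambda>j. h j - h k0" and ?n' = "\<lambda>j. h' j - h' k0"
  have "product_action act h z = product_action act ?n ?y"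
    using product_action_add[OF zt, of ?n "\<lambda>_. h k0"] by simp
  moreover have "product_action act h' z' = product_action act ?n' ?y'"
    using product_action_add[OF zt', of ?n' "\<lambda>_. h' k0"] by simp
  ultimately have ny: "product_action act ?n ?y = product_action act ?n' ?y'" using eq by simp
  \<comment> \<open>\<open>?d\<close> moves \<open>?y\<close> to \<open>?y'\<close>, and its
    coordinate at \<open>k0\<close> is 0. It vanishes as soon as all its coordinates lie in
    \<open>E\<close>.\<close>
  let ?d = "\<lambda>j. - (h' j - h' k0) + (h j - h k0)"
  have "product_action act ?d ?y = product_action act (\<lambda>j. - ?n' j) (product_action act ?n ?y)"
    by (rule product_action_add[OF yt])
  also have "\<dots> = product_action act (\<lambda>j. - ?n' j) (product_action act ?n' ?y')" by (simp only: ny)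
  also have "\<dots> = product_action act (\<lambda>j. - ?n' j + ?n' j) ?y'"
    by (rule product_action_add[OF yt', symmetric])
  also have "\<dots> = ?y'" unfolding left_minus by (rule product_action_zero[OF yt'])
  finally have dy: "product_action act ?d ?y = ?y'" .
  have "\<exists>v. (\<forall>j. v j \<in> V \<and> h j = v j + g)" using h by (intro choice) blast
  then obtain v where v: "\<And>j. v j \<in> V" "\<And>j. h j = v j + g" by blast
  have "\<exists>v. (\<forall>j. v j \<in> V \<and> h' j = v j + g')" using h' by (intro choice) blast
  then obtain v' where v': "\<And>j. v' j \<in> V" "\<And>j. h' j = v' j + g'" by blast
  \<comment> \<open>The translating elements \<open>g\<close> and \<open>g'\<close> drop out of the
    right differences, so \<open>?d\<close> is small however far apart the two translates
    are.\<close>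
  have cancel: "(a + g) - (b + g) = a - b" for a b g :: 'g
    by (simp only: diff_conv_add_uminus minus_add add.assoc add_minus_cancel)
  have "- (h' j - h' k0) + (h j - h k0) \<in> E" for j
    unfolding v(2) v'(2) cancel using V v(1) v'(1) by blast
  moreover have "- (h' k0 - h' k0) + (h k0 - h k0) = 0" by simp
  ultimately have "?d = (\<lambda>_. 0)" using E[rule_format, of ?d ?y] yI yI' dy by simp
  then have d0: "- (h' j - h' k0) + (h j - h k0) = 0" for j by (rule fun_cong)
  from arg_cong[OF d0[of j], of "\<lambda>x. (h' j - h' k0) + x"]
  show "h j - h k0 = h' j - h' k0" by (simp only: add_minus_cancel add_0_right)
  have "?y = ?y'"
    using dy unfolding \<open>?d = (\<lambda>_. 0)\<close> product_action_zero[OF yt] .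
  have "diag_act (- h' k0 + h k0) z = diag_act (- h' k0) ?y" by (rule diag_act_diff[OF zt])
  also have "\<dots> = z'" unfolding \<open>?y = ?y'\<close> by (rule diag_act_uminus[OF zt'])
  finally have q: "diag_act (- h' k0 + h k0) z = z'" .
  have "- h' k0 + h k0 \<in> K" by (rule wander[rule_format, OF z(1)]) (simp only: q z(2))
  moreover have "act k0 (- h' k0 + h k0) (z k0) = z' k0"
    using fun_cong[OF q, of k0] by (simp add: product_action_def)
  moreover have "z' k0 \<in> Z k0" using z(2) B by (auto simp: PiE_iff)
  ultimately show "- h' k0 + h k0 \<in> {q \<in> K. act k0 q (z k0) \<in> Z k0}" by simp
qed

text \<open>\<open>PiM_pushforward_bound\<close> for Haar measure restricted to the pieces
  \<open>Q k\<close>, which are small enough for each factor map to push forward below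
  \<open>\<mu> k\<close>.\<close>

lemma box_bound:
  assumes sep: "\<And>k. {h. act k h ` Z k \<inter> Z k \<noteq> {}} \<inter> U \<subseteq> {0}"
    and Q: "\<And>k. Q k \<in> sets borel" "\<And>k. emeasure m (Q k) < \<infinity>"
      "\<And>k a b. a \<in> Q k \<Longrightarrow> b \<in> Q k \<Longrightarrow> - a + b \<in> U"
    and B: "B \<in> sets (PiM UNIV \<nu>)" and S: "S \<in> sets (borel_of Y)"
    and sub: "\<And>h z. h \<in> Pi\<^sub>E UNIV Q \<Longrightarrow> z \<in> B \<Longrightarrow> product_action act h z \<in> S"
  shows "(\<Prod>k\<in>UNIV. emeasure m (Q k)) * emeasure (PiM UNIV \<nu>) B \<le> emeasure (PiM UNIV \<mu>) S"
proof -
  have spm: "space m = UNIV" using sets_eq_imp_space_eq[OF sets_m] by simp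
  have em: "emeasure (restrict_space m (Q k)) (Q k) = emeasure m (Q k)" for k
    using Q(1)[of k] sets_m by (subst emeasure_restrict_space) simp_all
  have sp: "space (restrict_space m (Q k)) = Q k" for k by (simp add: space_restrict_space spm)
  have fin: "finite_measure (restrict_space m (Q k))" for k
    using Q(2)[of k] by (intro finite_measureI) (simp add: em sp)
  have \<mu>_fin: "finite_measure (\<mu> k)" for k using \<mu>(2) by (rule prob_space.finite_measure)
  have "(\<Prod>k\<in>UNIV. emeasure (restrict_space m (Q k)) (space (restrict_space m (Q k))))
      * emeasure (PiM UNIV \<nu>) B \<le> emeasure (PiM UNIV \<mu>) S"
  proof (rule PiM_pushforward_bound[where a = "\<lambda>k. \<lambda>(g, x). act k g x", OF fin finite_\<nu> \<mu>_fin _ _ B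
        sets_borel_of_Y_PiM_\<mu>[OF S]])
    fix k
    show "(\<lambda>(g, x). act k g x) \<in> restrict_space m (Q k) \<Otimes>\<^sub>M \<nu> k \<rightarrow>\<^sub>M \<mu> k"
      "distr (restrict_space m (Q k) \<Otimes>\<^sub>M \<nu> k) (\<mu> k) (\<lambda>(g, x). act k g x) \<le> \<mu> k"
      by (rule distr_action_transverse_le[OF sets_m sc act \<mu>(1) Z_sets sep \<nu> finite_\<nu> Q(1,3)];
          assumption)+
  next
    fix h z assume "h \<in> space (PiM UNIV (\<lambda>k. restrict_space m (Q k)))" "z \<in> B"
    then have "product_action act h z \<in> S" by (intro sub) (simp_all add: space_PiM sp)
    then show "(\<lambda>i. case (h i, z i) of (g, x) \<Rightarrow> act i g x) \<in> S" by (simp add: product_action_def)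
  qed
  then show ?thesis by (simp only: sp em)
qed

text \<open>The order of choices matters: \<open>V\<close> and \<open>M\<close> are fixed before
  \<open>N\<close>, whereas the translates and the partition into small pieces depend on
  \<open>N\<close>.\<close>

lemma wandering_bound:
  assumes sep: "\<And>k. {h. act k h ` Z k \<inter> Z k \<noteq> {}} \<inter> U \<subseteq> {0}" and U: "open U" "0 \<in> U"
    and E: "\<forall>n x. n k0 = 0 \<and> (\<forall>j. n j \<in> E) \<and> x \<in> intersection_space X act Z \<and>
      product_action act n x \<in> intersection_space X act Z \<longrightarrow> n = (\<lambda>_. 0)"
    and VE: "\<forall>a\<in>V. \<forall>b\<in>V. \<forall>c\<in>V. \<forall>d\<in>V. - (a - b) + (c - d) \<in> E"
    and V: "compact V"
    and B: "compactin Y B" "B \<subseteq> Pi\<^sub>E UNIV Z"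
    and wander: "\<forall>z\<in>B. \<forall>g. diag_act g z \<in> B \<longrightarrow> g \<in> K"
    and M: "\<forall>s\<in>topspace (X k0). finite {q \<in> K. act k0 q s \<in> Z k0} \<and> card {q \<in> K. act k0 q s \<in> Z k0} \<le> M"
  shows "of_nat N * (emeasure m V ^ CARD('i) * emeasure (PiM UNIV \<nu>) B) \<le> of_nat M"
proof -
  obtain F where F: "finite F" "card F = N"
    "\<forall>g\<in>F. \<forall>g'\<in>F. g \<noteq> g' \<longrightarrow> (\<lambda>h. h + g) ` V \<inter> (\<lambda>h. h + g') ` V = {}"
    using disjoint_translates[OF V noncompact, of N] by (elim exE conjE)
  define T where "T g = (\<lambda>h. h + g) ` V" for g
  have T: "compact (T g)" for g unfolding T_def by (rule compact_translate(2)[OF V])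
  have "compact (\<Union>g\<in>F. T g)" using F(1) by (rule compact_UN) (simp add: T)
  from sigma_compact_small_partition[OF lc U this] obtain n Q where Q: "\<forall>i<n. sigma_compactin euclidean (Q i)"
    "\<forall>i<n. \<forall>a\<in>Q i. \<forall>b\<in>Q i. - a + b \<in> U"
    "\<forall>i<n. \<forall>j<n. i \<noteq> j \<longrightarrow> Q i \<inter> Q j = {}" "(\<Union>g\<in>F. T g) \<subseteq> (\<Union>i<n::nat. Q i)"
    by (elim exE conjE)
  \<comment> \<open>An index \<open>p\<close> consists of a choice of one small piece per coordinate
    and of one translate \<open>T g\<close> common to all coordinates. The sets \<open>P p k\<close>
    are \<sigma>-compact, so the action image \<open>S p\<close> is Borel.\<close>
  define I where "I = Pi\<^sub>E (UNIV :: 'i set) (\<lambda>_. {..<n})"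
  define P where "P p k = Q (fst p k) \<inter> T (snd p)" for p :: "('i \<Rightarrow> nat) \<times> 'g" and k :: 'i
  define S where "S p = (\<lambda>w. product_action act (fst w) (snd w)) ` (Pi\<^sub>E UNIV (P p) \<times> B)" for p
  have I: "finite I" unfolding I_def by (intro finite_PiE) simp_all
  have I_less: "i k < n" if "i \<in> I" for i k using that unfolding I_def by (auto simp: PiE_iff)
  have sigmaP: "sigma_compactin euclidean (P p k)" if "fst p \<in> I" for p k
    unfolding P_def
  proof (rule sigma_compactin_Int[OF Hausdorff_space_euclidean_t2])
    show "sigma_compactin euclidean (Q (fst p k))" using Q(1) I_less[OF that] by blast
    show "sigma_compactin euclidean (T (snd p))"
      using T by (intro compactin_imp_sigma_compactin) simp
  qed
  have borelT: "T g \<in> sets borel" for g by (intro borel_closed compact_imp_closed T)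
  have borelP: "P p k \<in> sets borel" if "fst p \<in> I" for p k
    using sigma_compactin_sets_borel_of[OF Hausdorff_space_euclidean_t2 sigmaP[OF that]] by simp
  have sigmaS: "sigma_compactin Y (S p)" if "fst p \<in> I" for p
    unfolding S_def
    by (intro sigma_compactin_image[OF _ continuous_map_product_action] sigma_compactin_Times
        sigma_compactin_PiE compactin_imp_sigma_compactin[OF B(1)] sigmaP that) simp_all
  have borelS: "S p \<in> sets (borel_of Y)" if "fst p \<in> I" for p
    by (rule sigma_compactin_sets_borel_of[OF Hausdorff_Y sigmaS[OF that]])
  have "B \<in> sets (borel_of Y)"
    by (intro closedin_sets_borel_of compactin_imp_closedin Hausdorff_Y B(1))
  from measurable_sets[OF id_measurable_\<nu> this]
  have BN: "B \<in> sets (PiM UNIV \<nu>)" using B(2) by (simp add: space_PiM space_\<nu> Int_absorb2)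
  have fin: "emeasure m (P p k) < \<infinity>" for p k
  proof -
    have "emeasure m (P p k) \<le> emeasure m (T (snd p))"
      using borelT sets_m by (intro emeasure_mono) (simp_all add: P_def)
    also have "\<dots> < \<infinity>" using haar T unfolding left_haar_measure_def by blast
    finally show ?thesis .
  qed
  have box: "(\<Prod>k\<in>UNIV. emeasure m (P p k)) * emeasure (PiM UNIV \<nu>) B \<le> emeasure (PiM UNIV \<mu>) (S p)"
    if p: "fst p \<in> I" for p
  proof (rule box_bound[OF sep borelP[OF p] fin _ BN borelS[OF p]])
    show "- a + b \<in> U" if "a \<in> P p k" "b \<in> P p k" for k a b
      using that Q(2) I_less[OF p] unfolding P_def by blast
    show "product_action act h z \<in> S p" if "h \<in> Pi\<^sub>E UNIV (P p)" "z \<in> B" for h z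
      unfolding S_def using that by (intro image_eqI[of _ _ "(h, z)"]) simp_all
  qed
  \<comment> \<open>The pieces cut \<open>T g\<close> into parts with total mass
    \<open>m(T g) = m(V)\<close>. Expanding the product of these sums over the coordinates gives one
    summand per choice \<open>i\<close>.\<close>
  have total: "(\<Sum>i\<in>I. \<Prod>k\<in>UNIV. emeasure m (P (i, g) k)) = emeasure m V ^ CARD('i)" if g: "g \<in> F" for g
  proof -
    have "(\<Sum>j<n. emeasure m (Q j \<inter> T g)) = emeasure m (T g)"
    proof -
      have "Q j \<inter> T g \<in> sets m" if "j < n" for j
      proof -
        have "Q j \<in> sets borel"
          using sigma_compactin_sets_borel_of[OF Hausdorff_space_euclidean_t2] Q(1) that by fastforce
        then show ?thesis using borelT sets_m by simp
      qed
      then have "(\<Sum>j<n. emeasure m (Q j \<inter> T g)) = emeasure m (\<Union>j<n. Q j \<inter> T g)"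
        using Q(3) by (intro sum_emeasure) (auto simp: disjoint_family_on_def)
      also have "(\<Union>j<n. Q j \<inter> T g) = T g" using Q(4) g by blast
      finally show ?thesis .
    qed
    also have "\<dots> = emeasure m V"
      unfolding T_def by (intro right_translate_emeasure[OF unimod haar] borel_closed compact_imp_closed V)
    finally have "(\<Prod>k\<in>(UNIV :: 'i set). \<Sum>j<n. emeasure m (Q j \<inter> T g)) = emeasure m V ^ CARD('i)"
      by simp
    moreover have "(\<Prod>k\<in>(UNIV :: 'i set). \<Sum>j<n. emeasure m (Q j \<inter> T g))
        = (\<Sum>i\<in>I. \<Prod>k\<in>UNIV. emeasure m (Q (i k) \<inter> T g))"
      unfolding I_def by (rule prod_sum_PiE) simp_all
    ultimately show ?thesis by (simp add: P_def)
  qed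
  have mult: "(\<Sum>p\<in>I \<times> F. indicator (S p) x) \<le> (of_nat M :: ennreal)" for x
  proof -
    define J where "J = {p \<in> I \<times> F. x \<in> S p}"
    have "card J \<le> M"
    proof (cases "J = {}")
      case False
      then obtain p0 where p0: "p0 \<in> J" by blast
      have "\<forall>p\<in>J. \<exists>w. w \<in> Pi\<^sub>E UNIV (P p) \<times> B \<and> x = product_action act (fst w) (snd w)"
        unfolding J_def S_def by blast
      then obtain w where w: "\<forall>p\<in>J. w p \<in> Pi\<^sub>E UNIV (P p) \<times> B \<and> x = product_action act (fst (w p)) (snd (w p))"
        by (rule bchoice[THEN exE])
      define h where "h p = fst (w p)" for p
      define z where "z p = snd (w p)" for p
      have hP: "h p k \<in> P p k" and zB: "z p \<in> B" and x: "x = product_action act (h p) (z p)"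
        if "p \<in> J" for p k
        using w that by (auto simp: h_def z_def mem_Times_iff PiE_iff)
      have hT: "\<forall>k. h p k \<in> (\<lambda>v. v + snd p) ` V" if "p \<in> J" for p
        using hP[OF that] unfolding P_def T_def by blast
      let ?R = "{q \<in> K. act k0 q (z p0 k0) \<in> Z k0}"
      have R: "h p0 j - h p0 k0 = h p j - h p k0" "- h p k0 + h p0 k0 \<in> ?R" if p: "p \<in> J" for p j
      proof -
        have "product_action act (h p0) (z p0) = product_action act (h p) (z p)"
          using x[OF p0] x[OF p] by metis
        from wandering_multiplicity[OF E VE B(2) wander hT[OF p0] hT[OF p] zB[OF p0] zB[OF p] this]
        show "h p0 j - h p0 k0 = h p j - h p k0" "- h p k0 + h p0 k0 \<in> ?R" .
      qed
      \<comment> \<open>With \<open>p0\<close> as base point, equal values mean equal coordinates at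
        \<open>k0\<close>. All kernel parts agree with that of \<open>p0\<close>, so
        \<open>h p\<close> and \<open>h p'\<close> agree entirely. Disjoint translates then recover
        \<open>snd p\<close>, and disjoint pieces recover \<open>fst p\<close>.\<close>
      have "inj_on (\<lambda>p. - h p k0 + h p0 k0) J"
      proof (rule inj_onI)
        fix p p' assume p: "p \<in> J" "p' \<in> J" and eq: "- h p k0 + h p0 k0 = - h p' k0 + h p0 k0"
        then have k0: "h p k0 = h p' k0" by simp
        have hh: "h p j = h p' j" for j
          using R(1)[OF p(1), of j] R(1)[OF p(2), of j] k0 by (metis diff_add_cancel)
        have "snd p = snd p'"
        proof (rule ccontr)
          assume "snd p \<noteq> snd p'"
          moreover have "snd p \<in> F" "snd p' \<in> F" using p unfolding J_def by force+
          ultimately have "(\<lambda>v. v + snd p) ` V \<inter> (\<lambda>v. v + snd p') ` V = {}" using F(3) by blast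
          then show False using hT[OF p(1), rule_format, of k0] hT[OF p(2), rule_format, of k0] k0
            by (metis IntI emptyE)
        qed
        moreover have "fst p = fst p'"
        proof
          fix k
          have "fst p \<in> I" "fst p' \<in> I" using p unfolding J_def by force+
          then have "fst p k < n" "fst p' k < n" by (simp_all add: I_less)
          moreover have "h p k \<in> Q (fst p k) \<inter> Q (fst p' k)"
            using hP[OF p(1), of k] hP[OF p(2), of k] hh[of k] unfolding P_def by simp
          ultimately show "fst p k = fst p' k" using Q(3) by blast
        qed
        ultimately show "p = p'" by (rule prod_eqI[rotated])
      qed
      moreover have "(\<lambda>p. - h p k0 + h p0 k0) ` J \<subseteq> ?R" using R(2) by blast
      moreover have "z p0 k0 \<in> topspace (X k0)"
        using zB[OF p0] B(2) Z_subset by (auto simp: PiE_iff)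
      then have "finite ?R" "card ?R \<le> M" using M by simp_all
      ultimately show ?thesis by (meson card_inj_on_le order_trans)
    qed simp
    have "(\<Sum>p\<in>I \<times> F. indicator (S p) x) = (\<Sum>p\<in>J. 1 :: ennreal)"
      unfolding J_def using I F(1) by (intro sum.mono_neutral_cong_right) (auto simp: indicator_def)
    also have "\<dots> = of_nat (card J)" by simp
    also have "\<dots> \<le> of_nat M" using \<open>card J \<le> M\<close> by simp
    finally show ?thesis .
  qed
  \<comment> \<open>The masses of the \<open>S p\<close> are summed under the integral, where the
    multiplicity bound applies pointwise.\<close>
  have "of_nat N * (emeasure m V ^ CARD('i) * emeasure (PiM UNIV \<nu>) B)
      = (\<Sum>g\<in>F. emeasure m V ^ CARD('i) * emeasure (PiM UNIV \<nu>) B)"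
    using F(2) by simp
  also have "\<dots> = (\<Sum>g\<in>F. \<Sum>i\<in>I. (\<Prod>k\<in>UNIV. emeasure m (P (i, g) k)) * emeasure (PiM UNIV \<nu>) B)"
    by (intro sum.cong refl) (simp add: total sum_distrib_right[symmetric])
  also have "\<dots> \<le> (\<Sum>g\<in>F. \<Sum>i\<in>I. emeasure (PiM UNIV \<mu>) (S (i, g)))"
    by (intro sum_mono box) simp
  also have "\<dots> = (\<Sum>p\<in>I \<times> F. emeasure (PiM UNIV \<mu>) (S p))"
    by (subst sum.swap) (simp add: sum.cartesian_product split_beta')
  also have "\<dots> = (\<Sum>p\<in>I \<times> F. \<integral>\<^sup>+ x. indicator (S p) x \<partial>PiM UNIV \<mu>)"
    using borelS by (intro sum.cong refl nn_integral_indicator[symmetric] sets_borel_of_Y_PiM_\<mu>) auto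
  also have "\<dots> = (\<integral>\<^sup>+ x. (\<Sum>p\<in>I \<times> F. indicator (S p) x) \<partial>PiM UNIV \<mu>)"
    using borelS
    by (intro nn_integral_sum[symmetric] borel_measurable_indicator sets_borel_of_Y_PiM_\<mu>) auto
  also have "\<dots> \<le> (\<integral>\<^sup>+ x. of_nat M \<partial>PiM UNIV \<mu>)" by (intro nn_integral_mono mult)
  also have "\<dots> = of_nat M"
    using prob_space.emeasure_space_1[OF prob_space_PiM[of UNIV \<mu>, OF \<mu>(2)]] by simp
  finally show ?thesis .
qed

lemma wandering_null_compactin:
  assumes B: "compactin Y B" "B \<subseteq> Pi\<^sub>E UNIV Z" and K: "compact K"
    and wander: "\<forall>z\<in>B. \<forall>g. diag_act g z \<in> B \<longrightarrow> g \<in> K"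
  shows "emeasure (PiM UNIV \<nu>) B = 0"
proof -
  \<comment> \<open>Types are non-empty, so there is a coordinate to take as reference;
    commensurability covers each choice.\<close>
  fix k0 :: 'i
  obtain E where E: "open E" "0 \<in> E" "\<forall>n x. n k0 = 0 \<and> (\<forall>j. n j \<in> E) \<and> x \<in> intersection_space X act Z \<and>
      product_action act n x \<in> intersection_space X act Z \<longrightarrow> n = (\<lambda>_. 0)"
    using kernel_separation[of k0] by (elim exE conjE)
  \<comment> \<open>Two rounds of shrinking, since the kernel element to be controlled is a left
    difference of two right differences of elements of \<open>V\<close>.\<close>
  obtain E1 where E1: "open E1" "0 \<in> E1" "\<forall>a\<in>E1. \<forall>b\<in>E1. - a + b \<in> E \<and> a - b \<in> E"
    using small_difference_neighbourhood[OF E(1,2)] by (elim exE conjE)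
  obtain E2 where E2: "open E2" "0 \<in> E2" "\<forall>a\<in>E2. \<forall>b\<in>E2. - a + b \<in> E1 \<and> a - b \<in> E1"
    using small_difference_neighbourhood[OF E1(1,2)] by (elim exE conjE)
  obtain W V where V: "open W" "0 \<in> W" "W \<subseteq> V" "compact V" "V \<subseteq> E2"
    using compact_neighbourhood[OF lc E2(1,2)] by blast
  have VE: "\<forall>a\<in>V. \<forall>b\<in>V. \<forall>c\<in>V. \<forall>d\<in>V. - (a - b) + (c - d) \<in> E"
    using E1(3) E2(3) V(5) by (meson subsetD)
  obtain U where U: "open U" "0 \<in> U" "\<forall>k. {h. act k h ` Z k \<inter> Z k \<noteq> {}} \<inter> U \<subseteq> {0}"
    using uniform_separation by (elim exE conjE)
  obtain M where M: "\<forall>s\<in>topspace (X k0). finite {q\<in>K. act k0 q s \<in> Z k0} \<and> card {q\<in>K. act k0 q s \<in> Z k0} \<le> M"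
    using card_returns_bounded[OF act U(1,2) U(3)[THEN spec, of k0] K] by (elim exE)
  let ?c = "emeasure m V ^ CARD('i) * emeasure (PiM UNIV \<nu>) B"
  have bound: "of_nat N * ?c \<le> of_nat M" for N
    by (rule wandering_bound[OF U(3)[rule_format] U(1,2) E(3) VE V(4) B wander M])
  have "?c = 0"
  proof (rule ccontr)
    assume "?c \<noteq> 0"
    \<comment> \<open>The case \<open>N = 1\<close> excludes the value \<infinity>, so that the
      Archimedean property of the reals yields the contradiction.\<close>
    moreover have "?c < \<infinity>" using bound[of 1] by (simp add: order_le_less_trans[OF _ of_nat_less_top])
    ultimately obtain r where r: "?c = ennreal r" "0 < r"
      by (cases "?c") (auto simp: less_top ennreal_eq_0_iff not_le)
    obtain N where "real M < real N * r" using reals_Archimedean3[OF r(2)] by blast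
    moreover have "ennreal (real N * r) \<le> ennreal (real M)"
      using bound[of N] r by (simp add: ennreal_mult ennreal_of_nat_eq_real_of_nat)
    ultimately show False using r(2) by (simp add: ennreal_le_iff)
  qed
  moreover have "emeasure m V \<noteq> 0"
  proof -
    have "emeasure m W \<le> emeasure m V"
      using V(3,4) sets_m by (intro emeasure_mono) (simp_all add: compact_imp_closed borel_closed)
    then show ?thesis using left_haar_measure_open_pos[OF haar V(1,2)] by auto
  qed
  ultimately show ?thesis by simp
qed

text \<open>The product of the \<open>\<nu> k\<close> lives on the product of the
  \<open>Z k\<close>, which is merely a Borel subset. Pushing it along the inclusion gives a finite
  Borel measure on a Polish space, to which inner regularity applies.\<close>

abbreviation \<nu>Y where "\<nu>Y \<equiv> distr (PiM UNIV \<nu>) (borel_of Y) (\<lambda>z. z)"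

lemma finite_\<nu>Y: "finite_measure \<nu>Y"
proof -
  interpret product_sigma_finite \<nu>
    using finite_\<nu> by (simp add: product_sigma_finite_def finite_measure.axioms(1))
  have "emeasure (PiM UNIV \<nu>) (Pi\<^sub>E UNIV (\<lambda>k. space (\<nu> k))) = (\<Prod>k\<in>UNIV. emeasure (\<nu> k) (space (\<nu> k)))"
    by (rule emeasure_PiM) simp_all
  also have "\<dots> < \<infinity>"
    using finite_measure.emeasure_finite[OF finite_\<nu>]
    by (simp add: ennreal_prod_eq_top less_top[symmetric])
  finally have "finite_measure (PiM UNIV \<nu>)" by (intro finite_measureI) (simp add: space_PiM)
  then show ?thesis by (rule finite_measure.finite_measure_distr[OF _ id_measurable_\<nu>])
qed

lemma emeasure_\<nu>Y:
  assumes "B \<in> sets (borel_of Y)" "B \<subseteq> Pi\<^sub>E UNIV Z"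
  shows "emeasure \<nu>Y B = emeasure (PiM UNIV \<nu>) B"
  using assms(2) by (subst emeasure_distr[OF id_measurable_\<nu> assms(1)]) (simp add: space_PiM space_\<nu> Int_absorb2)

text \<open>Subsets of \<open>B\<close> inherit the wandering condition with the same
  \<open>K\<close>, so all compact subsets of \<open>B\<close> are null.\<close>

lemma wandering_null:
  assumes B: "B \<in> sets (borel_of Y)" "B \<subseteq> Pi\<^sub>E UNIV Z" and K: "compact K"
    and wander: "\<forall>z\<in>B. \<forall>g. diag_act g z \<in> B \<longrightarrow> g \<in> K"
  shows "B \<in> null_sets \<nu>Y"
proof -
  interpret finite_measure \<nu>Y by (rule finite_\<nu>Y)
  have B': "B \<in> sets \<nu>Y" using B(1) by simp
  have "measure \<nu>Y B \<le> 0 + e" if e: "0 < e" for e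
  proof -
    obtain C where C: "compactin Y C" "C \<subseteq> B" "measure \<nu>Y (B - C) < e"
      using polish_inner_regular[OF polish_Y finite_\<nu>Y sets_distr B' e] by (elim exE conjE)
    have C': "C \<in> sets (borel_of Y)"
      by (intro closedin_sets_borel_of compactin_imp_closedin Hausdorff_Y C(1))
    have "C \<subseteq> Pi\<^sub>E UNIV Z" using C(2) B(2) by (rule order_trans)
    moreover have "\<forall>z\<in>C. \<forall>g. diag_act g z \<in> C \<longrightarrow> g \<in> K" using C(2) wander by blast
    ultimately have "emeasure \<nu>Y C = 0"
      using wandering_null_compactin[OF C(1) _ K] by (simp add: emeasure_\<nu>Y[OF C'])
    then have "measure \<nu>Y C = 0" by (simp add: measure_def)
    moreover have "measure \<nu>Y (B - C) = measure \<nu>Y B - measure \<nu>Y C"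
      using C' C(2) B' by (intro finite_measure_Diff) simp_all
    ultimately show ?thesis using C(3) by simp
  qed
  then have "measure \<nu>Y B \<le> 0" by (rule field_le_epsilon)
  then show ?thesis using B' by (intro null_setsI) (simp_all add: emeasure_eq_measure measure_le_0_iff)
qed

section \<open>Recurrence outside a null set\<close>

lemma PiE_Z_sets: "Pi\<^sub>E UNIV Z \<in> sets (borel_of Y)"
proof -
  have "(\<lambda>x. x k) -` Z k \<inter> space (borel_of Y) \<in> sets (borel_of Y)" for k
  proof (rule measurable_sets)
    show "Z k \<in> sets (borel_of (X k))" using Z_sets[of k] by (simp add: \<mu>(1))
    show "(\<lambda>x. x k) \<in> borel_of Y \<rightarrow>\<^sub>M borel_of (X k)"
      by (rule continuous_map_measurable[OF continuous_map_product_projection]) simp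
  qed
  then have "(\<Inter>k. (\<lambda>x. x k) -` Z k \<inter> space (borel_of Y)) \<in> sets (borel_of Y)"
    by (intro sets.finite_INT) simp_all
  moreover have "(\<Inter>k. (\<lambda>x. x k) -` Z k \<inter> space (borel_of Y)) = Pi\<^sub>E UNIV Z"
    using Z_subset by (fastforce simp: PiE_iff)
  ultimately show ?thesis by simp
qed

text \<open>The set is the projection of a set of pairs \<open>(g, z)\<close>. The complement of
  \<open>L\<close> is open, hence \<sigma>-compact, so the pairs form a \<sigma>-compact set and the
  projection is not just analytic.\<close>

lemma sigma_compactin_recurrent:
  assumes D: "sigma_compactin Y D" and L: "compact L"
  shows "sigma_compactin Y {z \<in> D. \<exists>g. g \<notin> L \<and> diag_act g z \<in> D}"
proof -
  obtain \<C> where \<C>: "countable \<C>" "\<forall>C\<in>\<C>. compactin Y C" "\<Union>\<C> = D"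
    using D unfolding sigma_compactin_def by (elim exE conjE)
  let ?P = "prod_topology euclidean Y" and ?f = "\<lambda>p. diag_act (fst p) (snd p)"
  define R where "R C = ((- L) \<times> D) \<inter> {p \<in> topspace ?P. ?f p \<in> C}" for C
  have "sigma_compactin euclidean (- L)"
    using L by (intro sigma_compactin_open lc open_Compl compact_imp_closed)
  then have LD: "sigma_compactin ?P ((- L) \<times> D)" using D by (rule sigma_compactin_Times)
  have "sigma_compactin ?P (R C)" if "C \<in> \<C>" for C
    unfolding R_def
  proof (rule sigma_compactin_Int_closedin[OF LD closedin_continuous_map_preimage[OF continuous_map_diag_act]])
    show "closedin Y C" using \<C>(2) that by (intro compactin_imp_closedin Hausdorff_Y) blast
  qed
  then have "sigma_compactin ?P (\<Union>C\<in>\<C>. R C)" by (intro sigma_compactin_UN \<C>(1))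
  then have "sigma_compactin Y (snd ` (\<Union>C\<in>\<C>. R C))"
    by (rule sigma_compactin_image[OF _ continuous_map_snd])
  moreover have "snd ` (\<Union>C\<in>\<C>. R C) = {z \<in> D. \<exists>g. g \<notin> L \<and> diag_act g z \<in> D}"
  proof (intro equalityI subsetI)
    fix z assume "z \<in> snd ` (\<Union>C\<in>\<C>. R C)"
    then obtain C p where p: "C \<in> \<C>" "p \<in> R C" "z = snd p" by blast
    then have "fst p \<notin> L" "z \<in> D" "diag_act (fst p) z \<in> D"
      using \<C>(3) unfolding R_def by auto
    then show "z \<in> {z \<in> D. \<exists>g. g \<notin> L \<and> diag_act g z \<in> D}" by blast
  next
    fix z assume "z \<in> {z \<in> D. \<exists>g. g \<notin> L \<and> diag_act g z \<in> D}"
    then obtain g where g: "z \<in> D" "g \<notin> L" "diag_act g z \<in> D" by blast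
    then obtain C where C: "C \<in> \<C>" "diag_act g z \<in> C" using \<C>(3) by blast
    have "z \<in> topspace Y" using sigma_compactin_subset_topspace[OF D] g(1) by blast
    then have "(g, z) \<in> R C" using g C unfolding R_def by simp
    then have "snd (g, z) \<in> snd ` (\<Union>C\<in>\<C>. R C)" using C(1) by blast
    then show "z \<in> snd ` (\<Union>C\<in>\<C>. R C)" by simp
  qed
  ultimately show ?thesis by simp
qed

text \<open>Diagonal choice along the basic neighbourhoods \<open>W 0, W 1, ...\<close> of
  \<open>z\<close>: \<open>g n\<close> avoids \<open>L n\<close> and returns \<open>z\<close> to
  \<open>W 0, ..., W n\<close> simultaneously. Their intersection is open, so it contains a member
  of \<open>\<B>\<close> around \<open>z\<close>, to which \<open>rec\<close> applies.\<close>

lemma recurrent_sequence: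
  assumes z: "z \<in> topspace Y"
    and \<B>: "countable \<B>" "\<forall>V\<in>\<B>. openin Y V"
      "\<forall>U x. openin Y U \<and> x \<in> U \<longrightarrow> (\<exists>V\<in>\<B>. x \<in> V \<and> V \<subseteq> U)"
    and L: "\<And>K. compact K \<Longrightarrow> \<exists>n. K \<subseteq> L n" "incseq L"
    and rec: "\<forall>V\<in>\<B>. \<forall>n. z \<in> V \<longrightarrow> (\<exists>g. g \<notin> L n \<and> diag_act g z \<in> V \<inter> Pi\<^sub>E UNIV Z)"
  shows "\<exists>g :: nat \<Rightarrow> 'g. (\<forall>n. g n \<in> (\<Inter>k. return_set (act k) (Z k) (z k))) \<and>
    (\<forall>k. limitin (X k) (\<lambda>n. act k (g n) (z k)) (z k) sequentially) \<and> tends_to_infinity g"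
proof -
  let ?\<B> = "{V \<in> \<B>. z \<in> V}"
  have cnt: "countable ?\<B>" using \<B>(1) by (rule countable_subset[rotated]) blast
  obtain V where "V \<in> \<B>" "z \<in> V"
    using \<B>(3)[rule_format, OF conjI[OF openin_topspace z]] by (elim bexE conjE)
  then have "?\<B> \<noteq> {}" by blast
  define W where "W = from_nat_into ?\<B>"
  have W: "range W = ?\<B>" unfolding W_def using \<open>?\<B> \<noteq> {}\<close> cnt by (rule range_from_nat_into)
  have "W i \<in> ?\<B>" for i unfolding W[symmetric] by (rule rangeI)
  then have W_in: "W i \<in> \<B>" "z \<in> W i" for i by simp_all
  have "\<exists>g. g \<notin> L n \<and> diag_act g z \<in> (\<Inter>i\<le>n. W i) \<inter> Pi\<^sub>E UNIV Z" for n
  proof -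
    have 1: "openin Y (\<Inter>i\<in>{..n}. W i)" using W_in(1) \<B>(2) by (intro openin_INT2) simp_all
    have 2: "z \<in> (\<Inter>i\<in>{..n}. W i)" using W_in(2) by simp
    obtain V where V: "V \<in> \<B>" "z \<in> V" "V \<subseteq> (\<Inter>i\<in>{..n}. W i)"
      using \<B>(3)[rule_format, OF conjI[OF 1 2]] by (elim bexE conjE)
    obtain g where "g \<notin> L n" "diag_act g z \<in> V \<inter> Pi\<^sub>E UNIV Z"
      using rec[rule_format, OF V(1,2), of n] by (elim exE conjE)
    then show ?thesis using V(3) by blast
  qed
  then have "\<exists>g. \<forall>n. g n \<notin> L n \<and> diag_act (g n) z \<in> (\<Inter>i\<le>n. W i) \<inter> Pi\<^sub>E UNIV Z"
    by (intro choice allI)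
  then obtain g where g: "\<forall>n. g n \<notin> L n \<and> diag_act (g n) z \<in> (\<Inter>i\<le>n. W i) \<inter> Pi\<^sub>E UNIV Z"
    by (elim exE)
  have "g n \<in> (\<Inter>k. return_set (act k) (Z k) (z k))" for n
  proof -
    have "diag_act (g n) z \<in> Pi\<^sub>E UNIV Z" using g by blast
    then show ?thesis by (simp add: return_set_def product_action_def PiE_iff)
  qed
  moreover have "limitin Y (\<lambda>n. diag_act (g n) z) z sequentially"
    unfolding limitin_def
  proof (intro conjI allI impI z)
    fix U assume "openin Y U \<and> z \<in> U"
    then obtain V where V: "V \<in> \<B>" "z \<in> V" "V \<subseteq> U" using \<B>(3) by blast
    then have "V \<in> range W" unfolding W by blast
    then obtain i where i: "V = W i" by blast
    have "diag_act (g n) z \<in> U" if "i \<le> n" for n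
      using g[rule_format, of n] that V(3) unfolding i by blast
    then show "\<forall>\<^sub>F n in sequentially. diag_act (g n) z \<in> U"
      unfolding eventually_sequentially by blast
  qed
  then have "limitin (X k) (\<lambda>n. act k (g n) (z k)) (z k) sequentially" for k
    unfolding limitin_componentwise by (simp add: product_action_def)
  moreover have "tends_to_infinity g"
    unfolding tends_to_infinity_def
  proof (intro allI impI)
    fix K :: "'g set" assume "compact K"
    then obtain N where N: "K \<subseteq> L N" using L(1) by blast
    have "g n \<notin> K" if "N \<le> n" for n
      using g[rule_format, of n] N incseqD[OF L(2) that] by blast
    then show "\<forall>\<^sub>F n in sequentially. g n \<notin> K" unfolding eventually_sequentially by blast
  qed
  ultimately show ?thesis by blast
qed

lemma AE_recurrent:
  "AE z in PiM UNIV \<nu>. \<exists>g :: nat \<Rightarrow> 'g. (\<forall>n. g n \<in> (\<Inter>k. return_set (act k) (Z k) (z k))) \<and>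
    (\<forall>k. limitin (X k) (\<lambda>n. act k (g n) (z k)) (z k) sequentially) \<and> tends_to_infinity g"
proof -
  obtain L :: "nat \<Rightarrow> 'g set" where L: "\<And>n. compact (L n)" "incseq L" "\<And>K. compact K \<Longrightarrow> \<exists>n. K \<subseteq> L n"
    by (rule compact_exhaustion[OF lc]) blast
  obtain \<B> where \<B>: "countable \<B>" "\<forall>V\<in>\<B>. openin Y V"
    "\<forall>U x. openin Y U \<and> x \<in> U \<longrightarrow> (\<exists>V\<in>\<B>. x \<in> V \<and> V \<subseteq> U)"
    using polish_Y unfolding polish_topology_def second_countable_def by (elim conjE exE)
  have "Pi\<^sub>E UNIV Z \<in> sets \<nu>Y" using PiE_Z_sets by simp
  from polish_sigma_compactin_conull[OF polish_Y finite_\<nu>Y sets_distr this]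
  obtain Z' where Z': "sigma_compactin Y Z'" "Z' \<subseteq> Pi\<^sub>E UNIV Z" "measure \<nu>Y (Pi\<^sub>E UNIV Z - Z') = 0"
    by (elim exE conjE)
  \<comment> \<open>Using the conull \<sigma>-compact \<open>Z'\<close> instead of the full product,
    and the fact that the open \<open>V\<close> is F_sigma, makes \<open>D V\<close> and hence
    \<open>A V n\<close> \<sigma>-compact.\<close>
  define D where "D V = Z' \<inter> V" for V
  define A where "A V n = {z \<in> D V. \<exists>g. g \<notin> L n \<and> diag_act g z \<in> D V}" for V n
  have D: "sigma_compactin Y (D V)" if "V \<in> \<B>" for V
    unfolding D_def using Z'(1) open_imp_fsigma_in[OF metrizable_Y] \<B>(2) that
    by (intro sigma_compactin_Int_fsigma_in) simp_all
  \<comment> \<open>No point of \<open>D V - A V n\<close> returns to \<open>D V\<close> outside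
    \<open>L n\<close>; in particular its returns to \<open>D V - A V n\<close> all lie in the
    compact set \<open>L n\<close>.\<close>
  have null: "D V - A V n \<in> null_sets \<nu>Y" if "V \<in> \<B>" for V n
  proof (rule wandering_null[OF _ _ L(1)[of n]])
    have "sigma_compactin Y (A V n)" unfolding A_def by (rule sigma_compactin_recurrent[OF D[OF that] L(1)])
    then show "D V - A V n \<in> sets (borel_of Y)"
      by (intro sets.Diff sigma_compactin_sets_borel_of Hausdorff_Y D that)
    show "D V - A V n \<subseteq> Pi\<^sub>E UNIV Z" using Z'(2) unfolding D_def by blast
    show "\<forall>z\<in>D V - A V n. \<forall>g. diag_act g z \<in> D V - A V n \<longrightarrow> g \<in> L n" unfolding A_def by blast
  qed
  \<comment> \<open>Base and exhaustion are countable, so a single null set serves all pairs of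
    \<open>V\<close> and \<open>n\<close>.\<close>
  have "AE z in \<nu>Y. \<forall>V\<in>\<B>. \<forall>n. z \<notin> D V - A V n"
    by (intro AE_ball_countable' \<B>(1)) (simp only: AE_all_countable, intro allI AE_not_in null)
  moreover have "AE z in \<nu>Y. z \<notin> Pi\<^sub>E UNIV Z - Z'"
  proof (rule AE_not_in, rule null_setsI)
    show "Pi\<^sub>E UNIV Z - Z' \<in> sets \<nu>Y"
      using PiE_Z_sets sigma_compactin_sets_borel_of[OF Hausdorff_Y Z'(1)] by simp
    show "emeasure \<nu>Y (Pi\<^sub>E UNIV Z - Z') = 0"
      using finite_measure.emeasure_eq_measure[OF finite_\<nu>Y] Z'(3) by simp
  qed
  ultimately have "AE z in \<nu>Y. (\<forall>V\<in>\<B>. \<forall>n. z \<notin> D V - A V n) \<and> z \<notin> Pi\<^sub>E UNIV Z - Z'" by (rule AE_conjI)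
  from AE_distrD[OF id_measurable_\<nu> this]
  have "AE z in PiM UNIV \<nu>. (\<forall>V\<in>\<B>. \<forall>n. z \<notin> D V - A V n) \<and> z \<notin> Pi\<^sub>E UNIV Z - Z'" .
  then show ?thesis
  proof (rule AE_mp[OF _ AE_I2[OF impI]])
    fix z assume "z \<in> space (PiM UNIV \<nu>)" and *: "(\<forall>V\<in>\<B>. \<forall>n. z \<notin> D V - A V n) \<and> z \<notin> Pi\<^sub>E UNIV Z - Z'"
    then have "z \<in> Pi\<^sub>E UNIV Z" by (simp add: space_PiM space_\<nu>)
    then have z': "z \<in> Z'" using * by blast
    have "z \<in> topspace Y" using sigma_compactin_subset_topspace[OF Z'(1)] z' by blast
    moreover have "\<forall>V\<in>\<B>. \<forall>n. z \<in> V \<longrightarrow> (\<exists>g. g \<notin> L n \<and> diag_act g z \<in> V \<inter> Pi\<^sub>E UNIV Z)"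
    proof (intro ballI allI impI)
      fix V n assume V: "V \<in> \<B>" "z \<in> V"
      then have "z \<in> A V n" using * z' unfolding D_def by blast
      then show "\<exists>g. g \<notin> L n \<and> diag_act g z \<in> V \<inter> Pi\<^sub>E UNIV Z"
        using Z'(2) unfolding A_def D_def by blast
    qed
    ultimately show "\<exists>g :: nat \<Rightarrow> 'g. (\<forall>n. g n \<in> (\<Inter>k. return_set (act k) (Z k) (z k))) \<and>
        (\<forall>k. limitin (X k) (\<lambda>n. act k (g n) (z k)) (z k) sequentially) \<and> tends_to_infinity g"
      by (intro recurrent_sequence[OF _ \<B> L(3,2)])
  qed
qed

end

theorem theorem1p10:
  fixes m :: "'g::{topological_group_add, second_countable_topology, t2_space} measure"
    and X :: "'i::finite \<Rightarrow> 'x topology"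
    and act :: "'i \<Rightarrow> 'g \<Rightarrow> 'x \<Rightarrow> 'x"
    and Z :: "'i \<Rightarrow> 'x set"
    and \<mu> \<nu> :: "'i \<Rightarrow> 'x measure"
  assumes "locally_compact_space (euclidean :: 'g topology)"
    and "\<not> compact (UNIV :: 'g set)"
    and "unimodular TYPE('g)"
    and "left_haar_measure m"
    and "\<And>k. polish_topology (X k)"
    and "\<And>k. continuous_action (act k) (X k)"
    and "\<And>k. separated_cross_section UNIV (act k) (borel_of (X k)) (Z k)"
    and "\<And>k. sets (\<mu> k) = sets (borel_of (X k))"
    and "\<And>k. prob_space (\<mu> k)"
    and "\<And>k. invariant_measure (act k) (\<mu> k)"
    and "\<And>k. transverse_measure m (act k) (\<mu> k) (Z k) (\<nu> k)"
    and "commensurable X act Z"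
  shows "AE z in PiM UNIV \<nu>.
           \<exists>g :: nat \<Rightarrow> 'g.
             (\<forall>n. g n \<in> (\<Inter>k. return_set (act k) (Z k) (z k))) \<and>
             (\<forall>k. limitin (X k) (\<lambda>n. act k (g n) (z k)) (z k) sequentially) \<and>
             tends_to_infinity g"
proof -
  interpret commensurable_sections m X act Z \<mu> \<nu>
    by (intro commensurable_sections.intro assms)
  show ?thesis by (rule AE_recurrent)
qed

end
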